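(* Let $(M,g)$ be an $n$-dimensional Riemannian manifold with an isometric action of a unimodular Lie group $G$ and a one-dimensional immersed connected submanifold $\tilde\Sigma\subset M$ as in the geometric setting of the context (polar action, with either the boundaryless or the boundary version of the regularity assumptions); let $\Sigma$ and $M_0$ be the associated objects. Assume that $M_0$ is dense in $M$. Let $u_1,u_2\in C^2(M)$ be two radial solutions of $$-\Delta_Mu+f(x,u(x))=0$$ on the whole manifold $M$. (1) Assume that there exists $p\in\Sigma$ with $u_1(p)=u_2(p)$ and $\nabla u_1(p)=\nabla u_2(p)$, and that one of the following holds: - $f\in C(M\times\mathbb R)$ is radial in the first variable, and for every compact $K\subset M\times\mathbb R$ there is $C_K>0$ with $|f(x,y_1)-f(x,y_2)|\le C_K|y_1-y_2|$ for all $(x,y_1),(x,y_2)\in K$; or - $u_1,u_2>0$, $f\in C(M\times(0,\infty))$ is radial in the first variable, and for every compact $K\subset M\times(0,\infty)$ there is $C_K>0$ with $|f(x,y_1)-f(x,y_2)|\le C_K|y_1-y_2|$ for all $(x,y_1),(x,y_2)\in K$. Then $u_1\equiv u_2$ in $M$. (2) Assume that $f\in C(M\times\mathbb R)$ is radial in the first variable, that for every compact $K\subset M\times\mathbb R$ there is $C_K>0$ with $|f(x,y_1)-f(x,y_2)|\le C_K|y_1-y_2|$ for all $(x,y_1),(x,y_2)\in K$, that $f(\cdot,0)=0$, and that there exists $p\in\Sigma$ with $u_1(p)=0$ and $\nabla u_1(p)=0$. Then $u_1\equiv0$ in $M$.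
   Context: Geometric setting. $M$ is a connected, paracompact, Hausdorff $n$-dimensional smooth manifold, possibly with boundary, with Riemannian metric $g$; $\Delta_M$ is the Laplace–Beltrami operator. A Lie group $G$ acts on $M$ by isometries, and $\tilde\Sigma$ is an immersed connected submanifold of $M$ such that for each $x\in\tilde\Sigma\setminus\partial M$ with $G\cdot x\ne\{x\}$ one has $T_xM=T_x\tilde\Sigma\oplus T_x(G\cdot x)$ (polar action). One of the following regularity assumptions holds. (a) $M$ has empty boundary; $\Sigma$ denotes the set of points of $\tilde\Sigma$ not fixed by the action, and $M_0=\{x\in M: G\cdot x\neq\{x\}\}$. (b) $M$ has boundary; $\Sigma$ denotes the set of points of $\tilde\Sigma$ that are neither fixed points nor boundary points, and $M_0=\{x\in M: G\cdot x\neq\{x\}\}\setminus\partial M$. In either case it is assumed that $\Sigma$ is an open, embedded, connected submanifold of $\tilde\Sigma$; that for $x\in\Sigma$ the orbit $G\cdot x$ has finite Riemannian measure $A(x)$ (the volume of the orbit as a submanifold of $M$), with $A:\Sigma\to\mathbb R^+$ smooth; and that $M_0$ is open in $M$. The $G$-action on $\Sigma$ gives the whole of $M_0$, i.e. $M_0=G\cdot\Sigma$. A function $u$ on $M$ is radial if $u(g\cdot x)=u(x)$ for all $g\in G$, $x\in M$; $f(x,y)$ is radial in the first variable if $f(g\cdot x,y)=f(x,y)$. *)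

theory Defs
  imports "HOL-Analysis.Analysis" "HOL-Algebra.Group_Action"
begin

section \<open>Differentiability on subsets of a normed space\<close>

text \<open>
  The sets \<open>S\<close> below are always relatively open in a model space: the whole space, a closed
  half-space, or a product of these. Derivatives within such a set are unique; at boundary points of
  a half-space they are one-sided. All derivatives up to order \<open>k\<close> exist and are continuous up to
  the boundary.
\<close>

primrec Ck_on ::
    "nat \<Rightarrow> 'a::real_normed_vector set \<Rightarrow> ('a \<Rightarrow> 'b::real_normed_vector) \<Rightarrow> bool" where
  "Ck_on 0 S f \<longleftrightarrow> continuous_on S f"
| "Ck_on (Suc k) S f \<longleftrightarrow>
     (\<forall>x\<in>S. f differentiable (at x within S)) \<and>
     (\<forall>v. Ck_on k S (\<lambda>x. frechet_derivative f (at x within S) v))"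

definition smooth_on ::
    "'a::real_normed_vector set \<Rightarrow> ('a \<Rightarrow> 'b::real_normed_vector) \<Rightarrow> bool" where
  "smooth_on S f \<longleftrightarrow> (\<forall>k. Ck_on k S f)"

definition partial_within :: "(real^'n) set \<Rightarrow> 'n \<Rightarrow> (real^'n \<Rightarrow> real) \<Rightarrow> real^'n \<Rightarrow> real" where
  "partial_within S i f y = frechet_derivative f (at y within S) (axis i 1)"


section \<open>Smooth manifolds, possibly with boundary\<close>

text \<open>
  A manifold is a whole (Hausdorff) type with an atlas; a chart is its domain with the coordinate
  map. Charts take values in a model set \<open>H\<close>: \<open>UNIV\<close> for manifolds without boundary,
  \<open>half_space\<close> for manifolds possibly with boundary. In the latter case, a manifold whose boundary
  \<open>bdry\<close> is empty is an ordinary manifold, since a ball is diffeomorphic to a ball in the interior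
  of the half-space.
\<close>

type_synonym ('m, 'e) chart = "'m set \<times> ('m \<Rightarrow> 'e)"
type_synonym ('m, 'e) atlas = "('m, 'e) chart set"

definition half_space :: "'e::euclidean_space set" where
  "half_space = {x. 0 \<le> x \<bullet> (SOME b. b \<in> Basis)}"

definition paracompact_space :: "'m::topological_space itself \<Rightarrow> bool" where
  "paracompact_space _ \<longleftrightarrow>
     (\<forall>\<U> :: 'm set set. (\<forall>U\<in>\<U>. open U) \<and> \<Union>\<U> = UNIV \<longrightarrow>
        (\<exists>\<V>. (\<forall>V\<in>\<V>. open V \<and> (\<exists>U\<in>\<U>. V \<subseteq> U)) \<and> \<Union>\<V> = UNIV \<and>
             locally_finite_in euclidean \<V>))"

definition is_chart ::
    "'e::real_normed_vector set \<Rightarrow> ('m::topological_space, 'e) chart \<Rightarrow> bool" where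
  "is_chart H = (\<lambda>(U, \<phi>).
     open U \<and> openin (top_of_set H) (\<phi> ` U) \<and> homeomorphism U (\<phi> ` U) \<phi> (inv_into U \<phi>))"

definition smooth_map ::
    "('m::topological_space, 'a::real_normed_vector) atlas \<Rightarrow>
     ('k::topological_space, 'b::real_normed_vector) atlas \<Rightarrow> ('m \<Rightarrow> 'k) \<Rightarrow> bool" where
  "smooth_map A B F \<longleftrightarrow>
     (\<forall>(U, \<phi>)\<in>A. continuous_on U F \<and>
        (\<forall>(V, \<psi>)\<in>B. smooth_on (\<phi> ` (U \<inter> F -` V)) (\<psi> \<circ> F \<circ> inv_into U \<phi>)))"

definition smooth_manifold ::
    "'e::real_normed_vector set \<Rightarrow> ('m::t2_space, 'e) atlas \<Rightarrow> bool" where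
  "smooth_manifold H A \<longleftrightarrow>
     paracompact_space TYPE('m) \<and> (\<Union>(U, \<phi>)\<in>A. U) = UNIV \<and> (\<forall>c\<in>A. is_chart H c) \<and>
     smooth_map A A id"

definition prod_atlas :: "('m, 'a) atlas \<Rightarrow> ('k, 'b) atlas \<Rightarrow> ('m \<times> 'k, 'a \<times> 'b) atlas" where
  "prod_atlas A B = (\<lambda>((U, \<phi>), (V, \<psi>)). (U \<times> V, map_prod \<phi> \<psi>)) ` (A \<times> B)"

definition bdry :: "('m, 'e::euclidean_space) atlas \<Rightarrow> 'm set" where
  "bdry A = {x. \<exists>(U, \<phi>)\<in>A. x \<in> U \<and> \<phi> x \<in> frontier half_space}"

text \<open>The set \<open>S\<close> is an open subset of the manifold.\<close>

definition Ck_fun ::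
    "('m, 'e::real_normed_vector) atlas \<Rightarrow> nat \<Rightarrow> 'm set \<Rightarrow> ('m \<Rightarrow> real) \<Rightarrow> bool" where
  "Ck_fun A k S f \<longleftrightarrow> (\<forall>(U, \<phi>)\<in>A. Ck_on k (\<phi> ` (U \<inter> S)) (f \<circ> inv_into U \<phi>))"

text \<open>
  The differential of \<open>F\<close> at \<open>x\<close>, as a linear map between the coordinate representations of the
  tangent spaces in the charts \<open>c\<close> (around \<open>x\<close>) and \<open>d\<close> (around \<open>F x\<close>).
\<close>

definition coord_deriv ::
    "('m, 'a::real_normed_vector) chart \<Rightarrow> ('k, 'b::real_normed_vector) chart \<Rightarrow>
     ('m \<Rightarrow> 'k) \<Rightarrow> 'm \<Rightarrow> 'a \<Rightarrow> 'b" where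
  "coord_deriv c d F x =
     frechet_derivative (snd d \<circ> F \<circ> inv_into (fst c) (snd c))
       (at (snd c x) within snd c ` (fst c \<inter> F -` fst d))"

definition immersion ::
    "('m::topological_space, 'a::real_normed_vector) atlas \<Rightarrow>
     ('k::topological_space, 'b::real_normed_vector) atlas \<Rightarrow> ('m \<Rightarrow> 'k) \<Rightarrow> bool" where
  "immersion A B F \<longleftrightarrow> smooth_map A B F \<and>
     (\<forall>c\<in>A. \<forall>d\<in>B. \<forall>x. x \<in> fst c \<and> F x \<in> fst d \<longrightarrow> inj (coord_deriv c d F x))"


section \<open>Riemannian metrics\<close>

text \<open>\<open>g c x\<close> is the Gram matrix of the metric at \<open>x\<close> in the coordinates of the chart \<open>c\<close>.\<close>

type_synonym ('m, 'n) metric_tensor = "('m, real^'n) chart \<Rightarrow> 'm \<Rightarrow> real^'n^'n"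

definition preserves_metric ::
    "('m, real^'n) atlas \<Rightarrow> ('m, 'n) metric_tensor \<Rightarrow> ('m \<Rightarrow> 'm) \<Rightarrow> bool" where
  "preserves_metric A g F \<longleftrightarrow>
     (\<forall>c\<in>A. \<forall>d\<in>A. \<forall>x. x \<in> fst c \<and> F x \<in> fst d \<longrightarrow>
        (\<forall>v w. coord_deriv c d F x v \<bullet> (g d (F x) *v coord_deriv c d F x w) = v \<bullet> (g c x *v w)))"

text \<open>The last conjunct is the transformation rule of a tensor under change of charts.\<close>

definition riemannian_metric ::
    "('m, real^'n) atlas \<Rightarrow> ('m, 'n) metric_tensor \<Rightarrow> bool" where
  "riemannian_metric A g \<longleftrightarrow>
     (\<forall>c\<in>A. smooth_on (snd c ` fst c) (g c \<circ> inv_into (fst c) (snd c)) \<and>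
        (\<forall>x\<in>fst c. transpose (g c x) = g c x \<and> (\<forall>v. v \<noteq> 0 \<longrightarrow> 0 < v \<bullet> (g c x *v v)))) \<and>
     preserves_metric A g id"

text \<open>Components \<open>g\<^sup>i\<^sup>j \<partial>\<^sub>j u\<close> of the gradient in the chart \<open>c\<close>.\<close>

definition grad ::
    "('m, 'n) metric_tensor \<Rightarrow> ('m, real^'n) chart \<Rightarrow> ('m \<Rightarrow> real) \<Rightarrow> 'm \<Rightarrow> real^'n" where
  "grad g c u x =
     matrix_inv (g c x) *v
       (\<chi> j. partial_within (snd c ` fst c) j (u \<circ> inv_into (fst c) (snd c)) (snd c x))"

text \<open>
  The Laplace--Beltrami operator \<open>(1 / \<rho>) \<partial>\<^sub>i (\<rho> g\<^sup>i\<^sup>j \<partial>\<^sub>j u)\<close>, with \<open>\<rho> = sqrt (det g)\<close>, computed in the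
  chart \<open>c\<close>. Its value does not depend on the chart around \<open>x\<close>.
\<close>

definition laplacian ::
    "('m, 'n) metric_tensor \<Rightarrow> ('m, real^'n) chart \<Rightarrow> ('m \<Rightarrow> real) \<Rightarrow> 'm \<Rightarrow> real" where
  "laplacian g c u x =
     (let \<psi> = inv_into (fst c) (snd c);
          \<rho> = (\<lambda>z. sqrt (det (g c z)))
      in (\<Sum>i\<in>UNIV. partial_within (snd c ` fst c) i
            (\<lambda>y. \<rho> (\<psi> y) * grad g c u (\<psi> y) $ i) (snd c x)) / \<rho> x)"


section \<open>Riemannian measure of an immersed submanifold\<close>

text \<open>
  \<open>\<real>\<^sup>k\<close> is realised as a coordinate subspace of \<open>real^'n\<close> spanned by \<open>k\<close> axes \<open>J\<close>, which also covers
  \<open>k = 0\<close>. Its Lebesgue measure is defined as the library defines \<open>lborel\<close>; for \<open>J = {}\<close> it is the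
  unit point mass at the origin.
\<close>

definition coord_subspace :: "'n set \<Rightarrow> (real^'n) set" where
  "coord_subspace J = {x. \<forall>i. i \<notin> J \<longrightarrow> x $ i = 0}"

definition coord_lebesgue :: "'n::finite set \<Rightarrow> (real^'n) measure" where
  "coord_lebesgue J =
     distr (Pi\<^sub>M J (\<lambda>_. lborel)) borel (\<lambda>f. \<chi> i. if i \<in> J then f i else 0)"

text \<open>
  A local parametrisation of a \<open>k\<close>-dimensional immersed submanifold with underlying set \<open>S\<close>: an
  injective immersion of an open subset \<open>W \<inter> coord_subspace J\<close> of \<open>\<real>\<^sup>k\<close> into the manifold, with image
  in \<open>S\<close>. Smoothness is expressed by a smooth extension to the open set \<open>W\<close>. For the orbits of a
  second countable Lie group, such maps with \<open>k\<close> the dimension of the orbit are exactly the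
  parametrisations of open pieces of the orbit with its own submanifold structure.
\<close>

definition local_param ::
    "('m::topological_space, real^'n) atlas \<Rightarrow> nat \<Rightarrow> 'm set \<Rightarrow>
     'n set \<Rightarrow> (real^'n) set \<Rightarrow> (real^'n \<Rightarrow> 'm) \<Rightarrow> bool" where
  "local_param A k S J W \<psi> \<longleftrightarrow>
     card J = k \<and> open W \<and> smooth_map {(W, id)} A \<psi> \<and>
     inj_on \<psi> (W \<inter> coord_subspace J) \<and> \<psi> ` (W \<inter> coord_subspace J) \<subseteq> S \<and>
     (\<forall>y \<in> W \<inter> coord_subspace J. \<forall>d\<in>A. \<psi> y \<in> fst d \<longrightarrow>
        inj_on (coord_deriv (W, id) d \<psi> y) (coord_subspace J))"

text \<open>
  Square root of the Gram determinant of the vectors \<open>\<partial>\<^sub>i \<psi>\<close>, \<open>i \<in> J\<close>. The matrix is padded by an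
  identity block, so that its determinant is that of the \<open>J \<times> J\<close> block. The value does not depend on
  the chart chosen around \<open>\<psi> y\<close>.
\<close>

definition volume_density ::
    "('m, real^'n) atlas \<Rightarrow> ('m, 'n) metric_tensor \<Rightarrow>
     'n set \<Rightarrow> (real^'n) set \<Rightarrow> (real^'n \<Rightarrow> 'm) \<Rightarrow> real^'n \<Rightarrow> real" where
  "volume_density A g J W \<psi> y =
     (let d = (SOME d. d \<in> A \<and> \<psi> y \<in> fst d);
          X = (\<lambda>i. coord_deriv (W, id) d \<psi> y (axis i 1))
      in sqrt (det (\<chi> i j. if i \<in> J \<and> j \<in> J then X i \<bullet> (g d (\<psi> y) *v X j)
                           else if i = j then 1 else 0)))"

text \<open>
  Total Riemannian measure: supremum over finite families of disjoint parametrised Borel pieces.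
\<close>

definition submanifold_volume ::
    "('m::topological_space, real^'n) atlas \<Rightarrow> ('m, 'n) metric_tensor \<Rightarrow> nat \<Rightarrow> 'm set \<Rightarrow> ennreal"
  where
  "submanifold_volume A g k S =
     (SUP P \<in> {P. finite P \<and>
                  (\<forall>(J, W, \<psi>, B)\<in>P. local_param A k S J W \<psi> \<and> B \<in> sets borel \<and>
                                    B \<subseteq> W \<inter> coord_subspace J) \<and>
                  disjoint_family_on (\<lambda>(J, W, \<psi>, B). \<psi> ` B) P}.
        \<Sum>(J, W, \<psi>, B)\<in>P.
          \<integral>\<^sup>+y. ennreal (volume_density A g J W \<psi> y) * indicator B y \<partial>coord_lebesgue J)"


section \<open>Lie groups and polar actions\<close>

text \<open>
  The model space of the charts of a Lie group is an arbitrary finite-dimensional normed space rather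
  than a Euclidean space, since the library's Euclidean spaces have positive dimension and discrete
  groups are to be included.
\<close>

definition lie_group ::
    "'g::{t2_space, second_countable_topology} monoid \<Rightarrow>
     ('g, 'h::real_normed_vector) atlas \<Rightarrow> bool" where
  "lie_group G AG \<longleftrightarrow>
     group G \<and> carrier G = UNIV \<and>
     (\<exists>B :: 'h set. finite B \<and> span B = UNIV) \<and> smooth_manifold UNIV AG \<and>
     smooth_map (prod_atlas AG AG) AG (\<lambda>(a, b). a \<otimes>\<^bsub>G\<^esub> b) \<and>
     smooth_map AG AG (\<lambda>a. inv\<^bsub>G\<^esub> a)"

text \<open>
  On a second countable locally compact group every Borel measure that is finite on compact sets is
  regular, so no regularity condition is needed.
\<close>

definition left_haar_measure ::
    "'g::{t2_space, second_countable_topology} monoid \<Rightarrow> 'g measure \<Rightarrow> bool" where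
  "left_haar_measure G \<mu> \<longleftrightarrow>
     sets \<mu> = sets borel \<and> emeasure \<mu> UNIV \<noteq> 0 \<and> (\<forall>K. compact K \<longrightarrow> emeasure \<mu> K < \<infinity>) \<and>
     (\<forall>a\<in>carrier G. \<forall>E\<in>sets borel. emeasure \<mu> ((\<lambda>x. a \<otimes>\<^bsub>G\<^esub> x) ` E) = emeasure \<mu> E)"

definition unimodular :: "'g::{t2_space, second_countable_topology} monoid \<Rightarrow> bool" where
  "unimodular G \<longleftrightarrow>
     (\<exists>\<mu>. left_haar_measure G \<mu> \<and>
        (\<forall>a\<in>carrier G. \<forall>E\<in>sets borel. emeasure \<mu> ((\<lambda>x. x \<otimes>\<^bsub>G\<^esub> a) ` E) = emeasure \<mu> E))"

text \<open>The set \<open>M\<^sub>0\<close>.\<close>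

definition regular_points ::
    "('m, real^'n) atlas \<Rightarrow> 'g monoid \<Rightarrow> ('g \<Rightarrow> 'm \<Rightarrow> 'm) \<Rightarrow> 'm set" where
  "regular_points AM G act = {x. orbit G act x \<noteq> {x}} - bdry AM"

text \<open>
  The submanifold \<open>\<Sigma>~\<close> is the image of an injective immersion \<open>\<iota>\<close> of a one-dimensional manifold,
  possibly with boundary, and \<open>\<Sigma>\<close> is \<open>\<iota> ` regular_params AM G act \<iota>\<close>.
\<close>

definition regular_params ::
    "('m, real^'n) atlas \<Rightarrow> 'g monoid \<Rightarrow> ('g \<Rightarrow> 'm \<Rightarrow> 'm) \<Rightarrow> ('l \<Rightarrow> 'm) \<Rightarrow> 'l set" where
  "regular_params AM G act \<iota> = {s. \<iota> s \<in> regular_points AM G act}"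

text \<open>
  Both regularity assumptions (without and with boundary) are covered: if \<open>bdry AM = {}\<close>, removing
  the boundary has no effect.

  In \<open>polar\<close>, the range of the differential of \<open>\<iota>\<close> is the tangent space of \<open>\<Sigma>~\<close>, and the range of the
  differential of the orbit map at the identity is the tangent space of the orbit. By \<open>polar\<close> the
  orbits through \<open>\<Sigma>\<close> have dimension \<open>CARD('n) - 1\<close>, whence the dimension in \<open>orbit_volume\<close>.

  In \<open>open_params\<close> and \<open>connected_params\<close>, the topology is that of \<open>\<Sigma>~\<close>; as an open subset, \<open>\<Sigma>\<close> is
  an embedded submanifold of \<open>\<Sigma>~\<close>.
\<close>

locale polar_setting =
  fixes AM :: "('m::t2_space, real^'n) atlas"
    and g :: "('m, 'n) metric_tensor"
    and G :: "'g::{t2_space, second_countable_topology} monoid"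
    and AG :: "('g, 'h::real_normed_vector) atlas"
    and act :: "'g \<Rightarrow> 'm \<Rightarrow> 'm"
    and AN :: "('l::t2_space, real) atlas"
    and \<iota> :: "'l \<Rightarrow> 'm"
  assumes manifold_M: "smooth_manifold half_space AM"
    and connected_M: "connected (UNIV :: 'm set)"
    and metric: "riemannian_metric AM g"
    and lie_group: "lie_group G AG"
    and action: "group_action G UNIV act"
    and smooth_action: "smooth_map (prod_atlas AG AM) AM (\<lambda>(a, x). act a x)"
    and isometric: "\<forall>a\<in>carrier G. preserves_metric AM g (act a)"
    and manifold_N: "smooth_manifold half_space AN"
    and connected_N: "connected (UNIV :: 'l set)"
    and immersed: "immersion AN AM \<iota>" "inj \<iota>"
    and polar: "\<forall>s \<in> regular_params AM G act \<iota>. \<forall>c\<in>AN. \<forall>d\<in>AM. \<forall>b\<in>AG.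
        s \<in> fst c \<and> \<iota> s \<in> fst d \<and> \<one>\<^bsub>G\<^esub> \<in> fst b \<longrightarrow>
        (let T = range (coord_deriv c d \<iota> s);
             T' = range (coord_deriv b d (\<lambda>a. act a (\<iota> s)) \<one>\<^bsub>G\<^esub>)
         in {v + w | v w. v \<in> T \<and> w \<in> T'} = UNIV \<and> T \<inter> T' = {0})"
    and open_params: "open (regular_params AM G act \<iota>)"
    and connected_params: "connected (regular_params AM G act \<iota>)"
    and orbit_volume: "\<forall>s \<in> regular_params AM G act \<iota>.
        0 < submanifold_volume AM g (CARD('n) - 1) (orbit G act (\<iota> s)) \<and>
        submanifold_volume AM g (CARD('n) - 1) (orbit G act (\<iota> s)) < \<infinity>"
    and smooth_orbit_volume: "\<forall>k. Ck_fun AN k (regular_params AM G act \<iota>)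
        (\<lambda>s. enn2real (submanifold_volume AM g (CARD('n) - 1) (orbit G act (\<iota> s))))"
    and open_regular: "open (regular_points AM G act)"
    and regular_eq: "regular_points AM G act =
        (\<Union>s \<in> regular_params AM G act \<iota>. orbit G act (\<iota> s))"


section \<open>Radial solutions\<close>

definition radial :: "'g monoid \<Rightarrow> ('g \<Rightarrow> 'm \<Rightarrow> 'm) \<Rightarrow> ('m \<Rightarrow> real) \<Rightarrow> bool" where
  "radial G act u \<longleftrightarrow> (\<forall>a\<in>carrier G. \<forall>x. u (act a x) = u x)"

definition solution ::
    "('m, real^'n) atlas \<Rightarrow> ('m, 'n) metric_tensor \<Rightarrow> ('m \<Rightarrow> real \<Rightarrow> real) \<Rightarrow>
     ('m \<Rightarrow> real) \<Rightarrow> bool" where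
  "solution AM g f u \<longleftrightarrow>
     (\<forall>x. \<forall>c\<in>AM. x \<in> fst c \<longrightarrow> - laplacian g c u x + f x (u x) = 0)"

text \<open>Only the values of \<open>f\<close> on \<open>UNIV \<times> Y\<close> matter.\<close>

definition radial_loc_lipschitz ::
    "'g monoid \<Rightarrow> ('g \<Rightarrow> 'm::topological_space \<Rightarrow> 'm) \<Rightarrow> real set \<Rightarrow>
     ('m \<Rightarrow> real \<Rightarrow> real) \<Rightarrow> bool" where
  "radial_loc_lipschitz G act Y f \<longleftrightarrow>
     continuous_on (UNIV \<times> Y) (\<lambda>(x, y). f x y) \<and>
     (\<forall>y\<in>Y. radial G act (\<lambda>x. f x y)) \<and>
     (\<forall>K. compact K \<and> K \<subseteq> UNIV \<times> Y \<longrightarrow>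
        (\<exists>C>0. \<forall>x y\<^sub>1 y\<^sub>2. (x, y\<^sub>1) \<in> K \<and> (x, y\<^sub>2) \<in> K \<longrightarrow>
           \<bar>f x y\<^sub>1 - f x y\<^sub>2\<bar> \<le> C * \<bar>y\<^sub>1 - y\<^sub>2\<bar>))"

end

theory Submission
  imports Defs
begin

text \<open>
  Near a regular point of the section, read in a chart, let \<open>v = u\<^sub>1 - u\<^sub>2\<close>, let \<open>e\<close> be a vector
  tangent to the section, and let \<open>l\<close> be the derivative of \<open>v\<close> along \<open>e\<close>. Radiality makes \<open>v\<close>
  constant along the fundamental vector fields of the action, which together with \<open>e\<close> span all
  directions by polarity. So the gradient of \<open>v\<close> is \<open>l N\<close> for a \<open>C\<^sup>1\<close> field \<open>N\<close>, and by symmetry of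
  the Hessian the gradient of \<open>l\<close> is parallel to \<open>N\<close> up to a multiple of \<open>l\<close>. The equation and the
  Lipschitz condition then bound the gradients of \<open>v\<close> and \<open>l\<close> by \<open>\<bar>v\<bar> + \<bar>l\<bar>\<close>. By Gronwall, if \<open>v\<close>
  and its gradient vanish at one point of a small ball, then \<open>v\<close> vanishes on the ball. Connectedness
  of the section, the action and density of the regular points spread this to the whole manifold.
\<close>

text \<open>The vector \<open>e\<close> is constant in the chart and tangent to the section only at
  the base point; nearby, only its transversality to the orbits persists, and the argument rests on
  that. Working in a full neighbourhood instead of on the curve keeps the Laplacian in divergence
  form, so no operator on the section has to be derived. The price is that the gradient of
  \<open>l\<close> has as many components as the manifold has dimensions, while the equation is one
  scalar relation. Symmetry of the Hessian reduces the unknowns to one, the derivative of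
  \<open>l\<close> along \<open>e\<close>. After multiplication by \<open>\<nu>\<close>, the product
  of \<open>e\<close> and \<open>N\<close>, the second-order part of the equation is this derivative
  times the quadratic form of the inverse metric at \<open>N\<close>, which is nonzero by
  definiteness. The field \<open>N\<close> solves a linear system whose matrix is the identity at
  the base point, hence is C1 near it. Since solutions are only C2, \<open>v\<close> and
  \<open>l\<close> can each be differentiated once, and this fixes the form of the argument: a
  first-order system for the pair.\<close>

section \<open>Functions with continuous derivatives\<close>

text \<open>\<open>frechet_derivative\<close> is a choice, but on an open set derivatives are
  unique, so any explicit candidate \<open>f'\<close> may replace it. Continuity is asked direction
  by direction, as in \<open>Ck_on\<close>.\<close>

lemma Ck_on_1I:
  assumes "open S" "\<And>x. x \<in> S \<Longrightarrow> (f has_derivative f' x) (at x)"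
    and "\<And>k. continuous_on S (\<lambda>x. f' x k)"
  shows "Ck_on (Suc 0) S f"
proof -
  have "frechet_derivative f (at x within S) = f' x" if "x \<in> S" for x
    using frechet_derivative_at[OF assms(2)[OF that]] at_within_open[OF that assms(1)] by simp
  moreover have "f differentiable (at x within S)" if "x \<in> S" for x
    using assms(2)[OF that] by (meson differentiable_at_withinI differentiable_def)
  ultimately show ?thesis
    using assms(3) by (auto simp: cong: continuous_on_cong)
qed

lemma Ck_on_1_iff:
  assumes "open S"
  shows "Ck_on (Suc 0) S f \<longleftrightarrow>
    (\<exists>f'. (\<forall>x\<in>S. (f has_derivative f' x) (at x)) \<and> (\<forall>k. continuous_on S (\<lambda>x. f' x k)))"
proof
  assume "Ck_on (Suc 0) S f"
  then show "\<exists>f'. (\<forall>x\<in>S. (f has_derivative f' x) (at x)) \<and> (\<forall>k. continuous_on S (\<lambda>x. f' x k))"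
    by (intro exI[of _ "\<lambda>x. frechet_derivative f (at x within S)"])
      (auto simp: at_within_open[OF _ assms] simp flip: frechet_derivative_works)
qed (use Ck_on_1I[OF assms] in blast)

lemma Ck_on_1_imp_continuous_on: "Ck_on (Suc 0) S f \<Longrightarrow> continuous_on S f"
  by (simp add: differentiable_imp_continuous_on differentiable_on_def)

lemma Ck_on_1_cong:
  assumes "open S" "Ck_on (Suc 0) S f" "\<And>x. x \<in> S \<Longrightarrow> f x = g x"
  shows "Ck_on (Suc 0) S g"
proof -
  obtain f' where f': "\<And>x. x \<in> S \<Longrightarrow> (f has_derivative f' x) (at x)"
    "\<And>k. continuous_on S (\<lambda>x. f' x k)" using assms(2) unfolding Ck_on_1_iff[OF assms(1)] by blast
  show ?thesis
    by (rule Ck_on_1I[OF assms(1), of _ f'])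
      (use has_derivative_transform_within_open[OF f'(1) assms(1)] assms(3) f'(2) in blast)+
qed

lemma Ck_on_1_subset:
  assumes "open S" "open T" "T \<subseteq> S" "Ck_on (Suc 0) S f"
  shows "Ck_on (Suc 0) T f"
  using assms(3,4) unfolding Ck_on_1_iff[OF assms(1)] Ck_on_1_iff[OF assms(2)]
  by (meson continuous_on_subset subsetD)

lemma Ck_on_1_const: "open S \<Longrightarrow> Ck_on (Suc 0) S (\<lambda>x. c)"
  by (rule Ck_on_1I[of _ _ "\<lambda>x k. 0"]) auto

lemma Ck_on_1_add:
  assumes S: "open S" and f: "Ck_on (Suc 0) S f" and g: "Ck_on (Suc 0) S g"
  shows "Ck_on (Suc 0) S (\<lambda>x. f x + g x)"
proof -
  obtain f' where "\<And>x. x \<in> S \<Longrightarrow> (f has_derivative f' x) (at x)"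
    "\<And>k. continuous_on S (\<lambda>x. f' x k)" using f unfolding Ck_on_1_iff[OF S] by blast
  moreover obtain g' where "\<And>x. x \<in> S \<Longrightarrow> (g has_derivative g' x) (at x)"
    "\<And>k. continuous_on S (\<lambda>x. g' x k)" using g unfolding Ck_on_1_iff[OF S] by blast
  ultimately show ?thesis
    by (intro Ck_on_1I[OF S, of _ "\<lambda>x k. f' x k + g' x k"])
      (auto intro!: derivative_eq_intros continuous_intros)
qed

lemma Ck_on_1_diff:
  assumes S: "open S" and f: "Ck_on (Suc 0) S f" and g: "Ck_on (Suc 0) S g"
  shows "Ck_on (Suc 0) S (\<lambda>x. f x - g x)"
proof -
  obtain f' where "\<And>x. x \<in> S \<Longrightarrow> (f has_derivative f' x) (at x)"
    "\<And>k. continuous_on S (\<lambda>x. f' x k)" using f unfolding Ck_on_1_iff[OF S] by blast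
  moreover obtain g' where "\<And>x. x \<in> S \<Longrightarrow> (g has_derivative g' x) (at x)"
    "\<And>k. continuous_on S (\<lambda>x. g' x k)" using g unfolding Ck_on_1_iff[OF S] by blast
  ultimately show ?thesis
    by (intro Ck_on_1I[OF S, of _ "\<lambda>x k. f' x k - g' x k"])
      (auto intro!: derivative_eq_intros continuous_intros)
qed

lemma Ck_on_1_mult:
  fixes f g :: "'a::real_normed_vector \<Rightarrow> real"
  assumes S: "open S" and f: "Ck_on (Suc 0) S f" and g: "Ck_on (Suc 0) S g"
  shows "Ck_on (Suc 0) S (\<lambda>x. f x * g x)"
proof -
  obtain f' where "\<And>x. x \<in> S \<Longrightarrow> (f has_derivative f' x) (at x)"
    "\<And>k. continuous_on S (\<lambda>x. f' x k)" using f unfolding Ck_on_1_iff[OF S] by blast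
  moreover obtain g' where "\<And>x. x \<in> S \<Longrightarrow> (g has_derivative g' x) (at x)"
    "\<And>k. continuous_on S (\<lambda>x. g' x k)" using g unfolding Ck_on_1_iff[OF S] by blast
  ultimately show ?thesis
    using f[THEN Ck_on_1_imp_continuous_on] g[THEN Ck_on_1_imp_continuous_on]
    by (intro Ck_on_1I[OF S, of _ "\<lambda>x k. f x * g' x k + f' x k * g x"])
      (auto intro!: derivative_eq_intros continuous_intros)
qed

lemma Ck_on_1_sum:
  assumes S: "open S" and f: "\<And>i. i \<in> I \<Longrightarrow> Ck_on (Suc 0) S (f i)"
  shows "Ck_on (Suc 0) S (\<lambda>x. \<Sum>i\<in>I. f i x)"
  using f by (induction I rule: infinite_finite_induct)
    (auto simp del: Ck_on.simps intro!: Ck_on_1_const[OF S] Ck_on_1_add[OF S])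

lemma Ck_on_1_prod:
  fixes f :: "'i \<Rightarrow> 'a::real_normed_vector \<Rightarrow> real"
  assumes S: "open S" and f: "\<And>i. i \<in> I \<Longrightarrow> Ck_on (Suc 0) S (f i)"
  shows "Ck_on (Suc 0) S (\<lambda>x. \<Prod>i\<in>I. f i x)"
  using f by (induction I rule: infinite_finite_induct)
    (auto simp del: Ck_on.simps intro!: Ck_on_1_const[OF S] Ck_on_1_mult[OF S])

lemma Ck_on_1_compose_real:
  fixes f :: "'a::real_normed_vector \<Rightarrow> real"
  assumes S: "open S" and f: "Ck_on (Suc 0) S f"
    and h: "\<And>x. x \<in> S \<Longrightarrow> (h has_real_derivative h' (f x)) (at (f x))"
    and h': "continuous_on (f ` S) h'"
  shows "Ck_on (Suc 0) S (\<lambda>x. h (f x))"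
proof -
  obtain f' where f': "\<And>x. x \<in> S \<Longrightarrow> (f has_derivative f' x) (at x)"
    "\<And>k. continuous_on S (\<lambda>x. f' x k)" using f unfolding Ck_on_1_iff[OF S] by blast
  show ?thesis
  proof (rule Ck_on_1I[OF S])
    show "((\<lambda>x. h (f x)) has_derivative (\<lambda>k. f' x k * h' (f x))) (at x)" if "x \<in> S" for x
      using DERIV_compose_FDERIV[OF h[OF that] f'(1)[OF that]] .
    show "continuous_on S (\<lambda>x. f' x k * h' (f x))" for k
      using f'(2) continuous_on_compose2[OF h' Ck_on_1_imp_continuous_on[OF f]]
      by (intro continuous_intros) auto
  qed
qed

lemma Ck_on_1_divide:
  fixes f g :: "'a::real_normed_vector \<Rightarrow> real"
  assumes S: "open S" and f: "Ck_on (Suc 0) S f" and g: "Ck_on (Suc 0) S g"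
    and nz: "\<And>x. x \<in> S \<Longrightarrow> g x \<noteq> 0"
  shows "Ck_on (Suc 0) S (\<lambda>x. f x / g x)"
proof -
  have "Ck_on (Suc 0) S (\<lambda>x. inverse (g x))"
    by (rule Ck_on_1_compose_real[OF S g, of _ "\<lambda>y. - (inverse y ^ Suc (Suc 0))"])
      (use nz in \<open>auto intro!: DERIV_inverse[simplified] continuous_intros simp del: mult_minus_left\<close>)
  then show ?thesis
    using Ck_on_1_mult[OF S f] by (simp only: divide_inverse)
qed

text \<open>The function \<open>sqrt\<close> is extended to negative arguments as an odd function,
  so it is differentiable at every nonzero point. For the density of the metric it is then enough
  that the determinant does not vanish.\<close>

lemma Ck_on_1_sqrt:
  fixes f :: "'a::real_normed_vector \<Rightarrow> real"
  assumes S: "open S" and f: "Ck_on (Suc 0) S f" and nz: "\<And>x. x \<in> S \<Longrightarrow> f x \<noteq> 0"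
  shows "Ck_on (Suc 0) S (\<lambda>x. sqrt (f x))"
proof (rule Ck_on_1_compose_real[OF S f])
  show "(sqrt has_real_derivative inverse (sqrt \<bar>f x\<bar>) / 2) (at (f x))" if "x \<in> S" for x
    using nz[OF that] by (intro DERIV_real_sqrt_generic) (simp_all add: real_sqrt_minus)
  show "continuous_on (f ` S) (\<lambda>y. inverse (sqrt \<bar>y\<bar>) / 2)"
    using nz by (intro continuous_intros) auto
qed

lemma Ck_on_1_vec_nth:
  fixes f :: "'a::real_normed_vector \<Rightarrow> 'b::real_normed_vector ^ 'n"
  assumes S: "open S" and f: "Ck_on (Suc 0) S f"
  shows "Ck_on (Suc 0) S (\<lambda>x. f x $ i)"
proof -
  obtain f' where f': "\<And>x. x \<in> S \<Longrightarrow> (f has_derivative f' x) (at x)"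
    "\<And>k. continuous_on S (\<lambda>x. f' x k)" using f unfolding Ck_on_1_iff[OF S] by blast
  show ?thesis
    by (rule Ck_on_1I[OF S bounded_linear.has_derivative[OF bounded_linear_vec_nth f'(1)]])
      (simp_all add: continuous_on_component f'(2))
qed

lemma Ck_on_1_det:
  fixes M :: "'a::real_normed_vector \<Rightarrow> real^'n^'n"
  assumes S: "open S" and M: "\<And>i j. Ck_on (Suc 0) S (\<lambda>x. M x $ i $ j)"
  shows "Ck_on (Suc 0) S (\<lambda>x. det (M x))"
  unfolding det_def
  by (intro Ck_on_1_sum Ck_on_1_mult Ck_on_1_prod Ck_on_1_const S M)

section \<open>Inverse matrices and Cramer's rule\<close>

lemma matrix_inv_mult:
  fixes M :: "real^'n^'n"
  assumes "det M \<noteq> 0"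
  shows "matrix_inv M ** M = mat 1" "M ** matrix_inv M = mat 1"
proof -
  have "\<exists>M'. M ** M' = mat 1 \<and> M' ** M = mat 1"
    using assms unfolding invertible_det_nz[symmetric] invertible_def .
  from someI_ex[OF this] show "matrix_inv M ** M = mat 1" "M ** matrix_inv M = mat 1"
    unfolding matrix_inv_def by auto
qed

lemma matrix_inv_vector_eq:
  fixes M :: "real^'n^'n"
  assumes "det M \<noteq> 0"
  shows "matrix_inv M *v b = x \<longleftrightarrow> M *v x = b"
  using matrix_inv_mult[OF assms]
  by (metis matrix_vector_mul_assoc matrix_vector_mul_lid)

text \<open>Column \<open>j\<close> of the inverse solves \<open>M x *v z = axis j 1\<close>, so
  Cramer's rule writes each entry as a quotient of determinants of C1 matrices.\<close>

lemma Ck_on_1_matrix_inv: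
  fixes M :: "'a::real_normed_vector \<Rightarrow> real^'n^'n"
  assumes S: "open S" and M: "\<And>i j. Ck_on (Suc 0) S (\<lambda>x. M x $ i $ j)"
    and nz: "\<And>x. x \<in> S \<Longrightarrow> det (M x) \<noteq> 0"
  shows "Ck_on (Suc 0) S (\<lambda>x. matrix_inv (M x) $ i $ j)"
proof (rule Ck_on_1_cong[OF S])
  let ?C = "\<lambda>x. \<chi> r c. if c = i then axis j 1 $ r else M x $ r $ c"
  show "Ck_on (Suc 0) S (\<lambda>x. det (?C x) / det (M x))"
  proof (intro Ck_on_1_divide Ck_on_1_det S M nz)
    show "Ck_on (Suc 0) S (\<lambda>x. ?C x $ r $ c)" for r c
    proof (cases "c = i")
      case True
      then show ?thesis using Ck_on_1_const[OF S] by (simp only: vec_lambda_beta if_True simp_thms)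
    next
      case False
      then show ?thesis using M by (simp only: vec_lambda_beta if_False)
    qed
  qed
  show "det (?C x) / det (M x) = matrix_inv (M x) $ i $ j" if "x \<in> S" for x
  proof -
    have "M x *v (\<chi> k. det (\<chi> r c. if c = k then axis j 1 $ r else M x $ r $ c) / det (M x)) = axis j 1"
      by (rule iffD2[OF cramer[OF nz[OF that]] refl])
    then have "matrix_inv (M x) *v axis j 1
        = (\<chi> k. det (\<chi> r c. if c = k then axis j 1 $ r else M x $ r $ c) / det (M x))"
      by (rule iffD2[OF matrix_inv_vector_eq[OF nz[OF that]]])
    then have "(matrix_inv (M x) *v axis j 1) $ i = det (?C x) / det (M x)"
      by (simp only: vec_lambda_beta)
    then show ?thesis
      by (simp only: matrix_vector_mult_basis column_def vec_lambda_beta)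
  qed
qed

section \<open>Derivatives within a set and derivatives at interior points\<close>

lemma frechet_derivative_cong:
  assumes "x \<in> S" "\<And>y. y \<in> S \<Longrightarrow> f y = g y"
  shows "frechet_derivative f (at x within S) = frechet_derivative g (at x within S)"
proof -
  have "(f has_derivative f') (at x within S) \<longleftrightarrow> (g has_derivative f') (at x within S)" for f'
    using assms by (metis has_derivative_transform)
  then show ?thesis unfolding frechet_derivative_def by simp
qed

lemma Ck_on_cong:
  assumes "\<And>x. x \<in> S \<Longrightarrow> f x = g x"
  shows "Ck_on k S f \<longleftrightarrow> Ck_on k S g"
  using assms
proof (induction k arbitrary: f g)
  case 0
  then show ?case by (simp cong: continuous_on_cong)
next
  case (Suc k)
  have "f differentiable (at x within S) \<longleftrightarrow> g differentiable (at x within S)" if "x \<in> S" for x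
    using Suc.prems that unfolding differentiable_def by (metis has_derivative_transform)
  moreover have "Ck_on k S (\<lambda>x. frechet_derivative f (at x within S) v) \<longleftrightarrow>
      Ck_on k S (\<lambda>x. frechet_derivative g (at x within S) v)" for v
    by (rule Suc.IH) (simp add: frechet_derivative_cong[of _ S f g] Suc.prems)
  ultimately show ?case by simp
qed

text \<open>In the applications \<open>S\<close> may be a chart image, only relatively open in a
  half-space. An open \<open>T\<close> inside it lies in its interior, where the filters
  \<open>at x within S\<close> and \<open>at x within T\<close> coincide, so one-sided derivatives
  do not interfere.\<close>

lemma Ck_on_open_subset:
  assumes "Ck_on k S f" "open T" "T \<subseteq> S"
  shows "Ck_on k T f"
  using assms(1)
proof (induction k arbitrary: f)
  case 0
  then show ?case using assms(3) continuous_on_subset by auto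
next
  case (Suc k)
  have "at x within S = at x within T" if "x \<in> T" for x
    using that assms(2,3) by (metis at_within_interior at_within_open interior_maximal subsetD)
  then have "f differentiable (at x within T)" if "x \<in> T" for x
    using Suc.prems assms(3) that unfolding Ck_on.simps by (metis subsetD)
  moreover have "Ck_on k T (\<lambda>x. frechet_derivative f (at x within T) v)" for v
  proof -
    have "Ck_on k T (\<lambda>x. frechet_derivative f (at x within S) v)"
      using Suc.IH Suc.prems unfolding Ck_on.simps by blast
    then show ?thesis
      by (rule iffD1[OF Ck_on_cong, rotated])
        (simp add: \<open>\<And>x. x \<in> T \<Longrightarrow> at x within S = at x within T\<close>)
  qed
  ultimately show ?case by simp
qed

lemma Ck_on_2_open:
  assumes "open S" "Ck_on (Suc (Suc 0)) S f"
  shows "x \<in> S \<Longrightarrow> (f has_derivative frechet_derivative f (at x)) (at x)"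
    and "Ck_on (Suc 0) S (\<lambda>x. frechet_derivative f (at x) k)"
proof -
  show "x \<in> S \<Longrightarrow> (f has_derivative frechet_derivative f (at x)) (at x)"
    using assms(2) at_within_open[OF _ assms(1), of x] unfolding Ck_on.simps(2)[of "Suc 0"]
    by (metis frechet_derivative_works)
  have "Ck_on (Suc 0) S (\<lambda>x. frechet_derivative f (at x within S) k)"
    using assms(2) unfolding Ck_on.simps(2)[of "Suc 0"] by blast
  then show "Ck_on (Suc 0) S (\<lambda>x. frechet_derivative f (at x) k)"
    by (rule Ck_on_1_cong[OF assms(1)]) (simp add: at_within_open[OF _ assms(1)])
qed

text \<open>Serves to freeze the group coordinate at the identity after the action, read in charts,
  has been differentiated in a group direction.\<close>

lemma Ck_on_1_slice:
  assumes T: "open T" and H: "Ck_on (Suc 0) T H" and S: "open S" "\<And>x. x \<in> S \<Longrightarrow> (y, x) \<in> T"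
  shows "Ck_on (Suc 0) S (\<lambda>x. H (y, x))"
proof -
  obtain H' where H': "\<And>z. z \<in> T \<Longrightarrow> (H has_derivative H' z) (at z)"
    "\<And>k. continuous_on T (\<lambda>z. H' z k)" using H unfolding Ck_on_1_iff[OF T] by blast
  show ?thesis
  proof (rule Ck_on_1I[OF S(1)])
    fix x assume x: "x \<in> S"
    have "((\<lambda>x. (y, x)) has_derivative (\<lambda>k. (0, k))) (at x)"
      by (auto intro!: derivative_eq_intros)
    from has_derivative_compose[OF this H'(1)[OF S(2)[OF x]]]
    show "((\<lambda>x. H (y, x)) has_derivative (\<lambda>k. H' (y, x) (0, k))) (at x)" .
  next
    show "continuous_on S (\<lambda>x. H' (y, x) (0, k))" for k
      by (rule continuous_on_compose2[OF H'(2)]) (auto intro!: continuous_intros S(2))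
  qed
qed

lemma Ck_on_1_has_derivative:
  assumes "open S" "Ck_on (Suc 0) S f" "x \<in> S"
  shows "(f has_derivative frechet_derivative f (at x)) (at x)"
proof -
  obtain f' where "(f has_derivative f' x) (at x)"
    using assms unfolding Ck_on_1_iff[OF assms(1)] by blast
  then show ?thesis using frechet_derivative_at by metis
qed

lemma Ck_on_2_imp_continuous_on: "Ck_on (Suc (Suc 0)) S f \<Longrightarrow> continuous_on S f"
  by (simp add: differentiable_imp_continuous_on differentiable_on_def)

lemma partial_within_interior:
  assumes "y \<in> interior S"
  shows "partial_within S j f y = frechet_derivative f (at y) (axis j 1)"
  unfolding partial_within_def at_within_interior[OF assms] ..

section \<open>Local unique continuation\<close>

lemma has_real_derivative_along_line:
  assumes "(u has_derivative u') (at (x + t *\<^sub>R k))"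
  shows "((\<lambda>t. u (x + t *\<^sub>R k)) has_real_derivative u' k) (at t)"
proof -
  have "((\<lambda>t. x + t *\<^sub>R k) has_derivative (\<lambda>s. s *\<^sub>R k)) (at t)"
    by (auto intro!: derivative_eq_intros)
  from has_derivative_compose[OF this assms]
  have "((\<lambda>t. u (x + t *\<^sub>R k)) has_derivative (\<lambda>s. u' (s *\<^sub>R k))) (at t)" .
  moreover have "(\<lambda>s. u' (s *\<^sub>R k)) = (*) (u' k)"
    using linear_cmul[OF has_derivative_linear[OF assms]] by (auto simp: mult.commute)
  ultimately show ?thesis by (simp add: has_field_derivative_def)
qed

text \<open>Schwarz's theorem. The second difference over a small parallelogram is symmetric in
  \<open>a\<close> and \<open>b\<close>, and it equals \<open>h\<^sup>2\<close> times either mixed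
  derivative at some nearby point; continuity carries the equality to \<open>x\<close>.\<close>

lemma second_derivative_symmetric:
  fixes f :: "'a::real_normed_vector \<Rightarrow> real"
  assumes S: "open S" and x: "x \<in> S"
    and f: "\<And>y. y \<in> S \<Longrightarrow> (f has_derivative f' y) (at y)"
    and fa: "\<And>y. y \<in> S \<Longrightarrow> ((\<lambda>y. f' y a) has_derivative fa y) (at y)"
    and fb: "\<And>y. y \<in> S \<Longrightarrow> ((\<lambda>y. f' y b) has_derivative fb y) (at y)"
    and cont: "continuous_on S (\<lambda>y. fa y b)" "continuous_on S (\<lambda>y. fb y a)"
  shows "fa x b = fb x a"
proof -
  obtain r where r: "r > 0" "ball x r \<subseteq> S"
    using S x openE by blast
  text \<open>The second difference quotient at mesh \<open>h\<close>, by the mean value theorem applied twice.\<close>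
  have mv: "\<exists>y\<in>ball x \<epsilon>. f (x + h *\<^sub>R a + h *\<^sub>R b) - f (x + h *\<^sub>R a) - f (x + h *\<^sub>R b) + f x = h\<^sup>2 * fa y b"
    if f: "\<And>y. y \<in> S \<Longrightarrow> (f has_derivative f' y) (at y)"
      and fa: "\<And>y. y \<in> S \<Longrightarrow> ((\<lambda>y. f' y a) has_derivative fa y) (at y)"
      and h: "0 < h" "h * (norm a + norm b) < \<epsilon>" "\<epsilon> \<le> r"
    for h \<epsilon> a b and fa :: "'a \<Rightarrow> 'a \<Rightarrow> real"
  proof -
    have near: "x + s *\<^sub>R a + t *\<^sub>R b \<in> ball x \<epsilon>" if "0 \<le> s" "s \<le> h" "0 \<le> t" "t \<le> h" for s t
    proof -
      have "norm (s *\<^sub>R a + t *\<^sub>R b) \<le> s * norm a + t * norm b"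
        using that by (intro order_trans[OF norm_triangle_ineq]) simp
      also have "\<dots> \<le> h * norm a + h * norm b"
        using that by (intro add_mono mult_right_mono) auto
      also have "\<dots> < \<epsilon>" using h by (simp add: algebra_simps)
      finally show ?thesis
        by (metis dist_norm mem_ball add.assoc add_diff_cancel_left' dist_commute)
    qed
    then have inS: "x + s *\<^sub>R a + t *\<^sub>R b \<in> S" if "0 \<le> s" "s \<le> h" "0 \<le> t" "t \<le> h" for s t
      using that r h(3) by (meson subset_ball subsetD)
    \<comment> \<open>The term \<open>0 *\<^sub>R b\<close> stays unsimplified so that
      \<open>d1\<close> covers both summands, with \<open>t = h\<close> and
      \<open>t = 0\<close>.\<close>
    let ?\<phi> = "\<lambda>s. f (x + s *\<^sub>R a + h *\<^sub>R b) - f (x + s *\<^sub>R a + 0 *\<^sub>R b)"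
    let ?\<phi>' = "\<lambda>s. f' (x + s *\<^sub>R a + h *\<^sub>R b) a - f' (x + s *\<^sub>R a + 0 *\<^sub>R b) a"
    have d1: "((\<lambda>s. f (x + s *\<^sub>R a + t *\<^sub>R b)) has_real_derivative f' (x + s *\<^sub>R a + t *\<^sub>R b) a) (at s)"
      if "0 \<le> s" "s \<le> h" "0 \<le> t" "t \<le> h" for s t
      using has_real_derivative_along_line[of f _ "x + t *\<^sub>R b" s a] f[OF inS[OF that]]
      by (simp add: ac_simps)
    have "\<exists>z>0. z < h \<and> ?\<phi> h - ?\<phi> 0 = (h - 0) * ?\<phi>' z"
      using h d1 by (intro MVT2) (auto intro!: DERIV_diff simp del: scaleR_zero_left)
    then obtain z where z: "0 < z" "z < h" "?\<phi> h - ?\<phi> 0 = h * ?\<phi>' z" by auto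
    have "((\<lambda>t. f' (x + z *\<^sub>R a + t *\<^sub>R b) a) has_real_derivative fa (x + z *\<^sub>R a + t *\<^sub>R b) b) (at t)"
      if "0 \<le> t" "t \<le> h" for t
      using has_real_derivative_along_line[OF fa[OF inS[of z t]]] z that by simp
    then have "\<exists>t>0. t < h \<and> ?\<phi>' z = (h - 0) * fa (x + z *\<^sub>R a + t *\<^sub>R b) b"
      using h by (intro MVT2) auto
    then obtain t where t: "0 < t" "t < h" "?\<phi>' z = h * fa (x + z *\<^sub>R a + t *\<^sub>R b) b" by auto
    show ?thesis
      using z t near[of z t] by (intro bexI[of _ "x + z *\<^sub>R a + t *\<^sub>R b"]) (auto simp: power2_eq_square)
  qed
  have close: "\<exists>y\<in>ball x \<epsilon>. \<exists>z\<in>ball x \<epsilon>. fa y b = fb z a" if eps: "\<epsilon> > 0" "\<epsilon> \<le> r" for \<epsilon>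
  proof -
    \<comment> \<open>The summand 1 keeps the denominator positive even if \<open>a\<close> and
      \<open>b\<close> vanish.\<close>
    define h where "h = \<epsilon> / (2 * (norm a + norm b + 1))"
    have "h > 0" using that unfolding h_def by (simp add: add_nonneg_pos)
    have "h * (norm a + norm b) < h * (2 * (norm a + norm b + 1))"
      using \<open>h > 0\<close> by (intro mult_strict_left_mono) (auto simp: add_nonneg_pos)
    also have "\<dots> = \<epsilon>" unfolding h_def
      by (simp add: add_nonneg_eq_0_iff add_nonneg_pos less_imp_neq[symmetric])
    finally have small: "h * (norm a + norm b) < \<epsilon>" .
    obtain y where y: "y \<in> ball x \<epsilon>"
      "f (x + h *\<^sub>R a + h *\<^sub>R b) - f (x + h *\<^sub>R a) - f (x + h *\<^sub>R b) + f x = h\<^sup>2 * fa y b"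
      using mv[OF f fa \<open>h > 0\<close> small eps(2)] by blast
    obtain z where z: "z \<in> ball x \<epsilon>"
      "f (x + h *\<^sub>R b + h *\<^sub>R a) - f (x + h *\<^sub>R b) - f (x + h *\<^sub>R a) + f x = h\<^sup>2 * fb z a"
      using mv[OF f fb \<open>h > 0\<close> small[unfolded add.commute[of "norm a"]] eps(2)] by blast
    have "h\<^sup>2 * fa y b = h\<^sup>2 * fb z a"
      using y(2) z(2) by (simp add: algebra_simps)
    then have "fa y b = fb z a" using \<open>h > 0\<close> by simp
    then show ?thesis using y z by blast
  qed
  show ?thesis
  proof (rule ccontr)
    assume "fa x b \<noteq> fb x a"
    then have pos: "\<bar>fa x b - fb x a\<bar> / 2 > 0" by simp
    obtain d1 where d1: "d1 > 0" "\<And>y. y \<in> S \<Longrightarrow> dist y x < d1 \<Longrightarrow> dist (fa y b) (fa x b) < \<bar>fa x b - fb x a\<bar> / 2"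
      using cont(1) x pos unfolding continuous_on_iff by blast
    obtain d2 where d2: "d2 > 0" "\<And>y. y \<in> S \<Longrightarrow> dist y x < d2 \<Longrightarrow> dist (fb y a) (fb x a) < \<bar>fa x b - fb x a\<bar> / 2"
      using cont(2) x pos unfolding continuous_on_iff by blast
    \<comment> \<open>The common value would lie within half the gap of both \<open>fa x b\<close>
      and \<open>fb x a\<close>.\<close>
    obtain y z where "y \<in> ball x (min r (min d1 d2))" "z \<in> ball x (min r (min d1 d2))" "fa y b = fb z a"
      using close[of "min r (min d1 d2)"] r d1 d2 by auto
    then have "\<bar>fa y b - fa x b\<bar> < \<bar>fa x b - fb x a\<bar> / 2" "\<bar>fa y b - fb x a\<bar> < \<bar>fa x b - fb x a\<bar> / 2"
      using d1(2)[of y] d2(2)[of z] r by (auto simp: dist_commute dist_real_def subset_iff abs_minus_commute)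
    then show False by argo
  qed
qed

text \<open>Gronwall's argument along segments, for the energy \<open>v\<^sup>2 + l\<^sup>2\<close>.\<close>

lemma vanish_on_ball:
  fixes v l :: "'a::real_normed_vector \<Rightarrow> real"
  assumes v: "\<And>x. x \<in> ball x0 r \<Longrightarrow> (v has_derivative v' x) (at x)"
    and l: "\<And>x. x \<in> ball x0 r \<Longrightarrow> (l has_derivative l' x) (at x)"
    and K: "K \<ge> 0"
    and v': "\<And>x k. x \<in> ball x0 r \<Longrightarrow> \<bar>v' x k\<bar> \<le> K * norm k * \<bar>l x\<bar>"
    and l': "\<And>x k. x \<in> ball x0 r \<Longrightarrow> \<bar>l' x k\<bar> \<le> K * norm k * (\<bar>v x\<bar> + \<bar>l x\<bar>)"
    and x1: "x1 \<in> ball x0 r" "v x1 = 0" "l x1 = 0"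
    and x2: "x2 \<in> ball x0 r"
  shows "v x2 = 0"
proof -
  define k where "k = x2 - x1"
  define c where "c = K * norm k"
  have c: "c \<ge> 0" unfolding c_def using K by simp
  have seg: "x1 + t *\<^sub>R k \<in> ball x0 r" if "0 \<le> t" "t \<le> 1" for t
  proof -
    have "(1 - t) *\<^sub>R x1 + t *\<^sub>R x2 \<in> ball x0 r"
      using convexD_alt[OF convex_ball x1(1) x2] that by blast
    then show ?thesis by (simp add: k_def algebra_simps)
  qed
  \<comment> \<open>The rate 4: the bounds on the derivatives give at most 4c|v||l| + 2cl^2 for the
    derivative of v^2 + l^2 along the segment, and 2|v||l| <= v^2 + l^2 absorbs this into 4c(v^2 +
    l^2). So the weighted energy does not increase from its value 0 at \<open>x1\<close>.\<close>
  define E where "E = (\<lambda>t. ((v (x1 + t *\<^sub>R k))\<^sup>2 + (l (x1 + t *\<^sub>R k))\<^sup>2) * exp (- 4 * c * t))"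
  have chain: "((\<lambda>t. u (x1 + t *\<^sub>R k)) has_real_derivative u' (x1 + t *\<^sub>R k) k) (at t)"
    if u: "\<And>x. x \<in> ball x0 r \<Longrightarrow> (u has_derivative u' x) (at x)" and t: "0 \<le> t" "t \<le> 1"
    for u :: "'a \<Rightarrow> real" and u' t
    by (rule has_real_derivative_along_line[OF u[OF seg[OF t]]])
  have "E 1 \<le> E 0"
  proof (rule DERIV_nonpos_imp_nonincreasing[of 0 1 E])
    fix t :: real assume t: "0 \<le> t" "t \<le> 1"
    let ?x = "x1 + t *\<^sub>R k"
    have "((\<lambda>t. (v (x1 + t *\<^sub>R k))\<^sup>2) has_real_derivative 2 * v ?x * v' ?x k) (at t)"
      "((\<lambda>t. (l (x1 + t *\<^sub>R k))\<^sup>2) has_real_derivative 2 * l ?x * l' ?x k) (at t)"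
      using DERIV_power[OF chain[OF v t], of 2] DERIV_power[OF chain[OF l t], of 2]
      by (simp_all add: mult_ac)
    note DERIV_add[OF this]
    moreover have "((\<lambda>t. exp (- 4 * c * t)) has_real_derivative - 4 * c * exp (- 4 * c * t)) (at t)"
      by (auto intro!: derivative_eq_intros)
    ultimately have "(E has_real_derivative
        (2 * v ?x * v' ?x k + 2 * l ?x * l' ?x k) * exp (- 4 * c * t)
        + - 4 * c * exp (- 4 * c * t) * ((v ?x)\<^sup>2 + (l ?x)\<^sup>2)) (at t)"
      unfolding E_def by (rule DERIV_mult)
    then have "(E has_real_derivative
        (2 * v ?x * v' ?x k + 2 * l ?x * l' ?x k - 4 * c * ((v ?x)\<^sup>2 + (l ?x)\<^sup>2)) * exp (- 4 * c * t)) (at t)"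
      by (rule DERIV_cong) (simp only: algebra_simps)
    moreover have "2 * v ?x * v' ?x k + 2 * l ?x * l' ?x k \<le> 4 * c * ((v ?x)\<^sup>2 + (l ?x)\<^sup>2)"
    proof -
      have "v ?x * v' ?x k \<le> \<bar>v ?x\<bar> * \<bar>v' ?x k\<bar>"
        by (metis abs_ge_self abs_mult)
      also have "\<dots> \<le> \<bar>v ?x\<bar> * (c * \<bar>l ?x\<bar>)"
        using v'[OF seg[OF t], of k] unfolding c_def by (intro mult_left_mono) auto
      finally have 1: "v ?x * v' ?x k \<le> c * (\<bar>v ?x\<bar> * \<bar>l ?x\<bar>)" by (simp only: mult_ac)
      have "l ?x * l' ?x k \<le> \<bar>l ?x\<bar> * \<bar>l' ?x k\<bar>"
        by (metis abs_ge_self abs_mult)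
      also have "\<dots> \<le> \<bar>l ?x\<bar> * (c * (\<bar>v ?x\<bar> + \<bar>l ?x\<bar>))"
        using l'[OF seg[OF t], of k] unfolding c_def by (intro mult_left_mono) auto
      also have "\<dots> = c * (\<bar>v ?x\<bar> * \<bar>l ?x\<bar>) + c * \<bar>l ?x\<bar>\<^sup>2"
        by (simp only: algebra_simps power2_eq_square)
      finally have 2: "l ?x * l' ?x k \<le> c * (\<bar>v ?x\<bar> * \<bar>l ?x\<bar>) + c * (l ?x)\<^sup>2"
        by (simp only: power2_abs)
      have 3: "2 * (\<bar>v ?x\<bar> * \<bar>l ?x\<bar>) \<le> (v ?x)\<^sup>2 + (l ?x)\<^sup>2"
        using sum_squares_bound[of "\<bar>v ?x\<bar>" "\<bar>l ?x\<bar>"] by simp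
      have "c * (2 * (\<bar>v ?x\<bar> * \<bar>l ?x\<bar>)) \<le> c * ((v ?x)\<^sup>2 + (l ?x)\<^sup>2)"
        by (rule mult_left_mono[OF 3 c])
      moreover have "0 \<le> c * (v ?x)\<^sup>2" using c by simp
      ultimately show ?thesis using 1 2 by (simp only: distrib_left)
    qed
    ultimately show "\<exists>y. (E has_real_derivative y) (at t) \<and> y \<le> 0"
      by (intro exI conjI) (assumption, rule mult_nonpos_nonneg, simp_all)
  qed simp
  also have "E 0 = 0" using x1 by (simp add: E_def)
  finally have "(v x2)\<^sup>2 + (l x2)\<^sup>2 \<le> 0"
    by (simp add: E_def k_def mult_le_0_iff)
  then show ?thesis by (simp add: sum_power2_le_zero_iff)
qed

lemma linear_axis_expansion:
  fixes f :: "real^'n \<Rightarrow> real"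
  assumes "linear f"
  shows "f h = (\<Sum>k\<in>UNIV. h $ k * f (axis k 1))"
proof -
  have "f h = f (\<Sum>k\<in>UNIV. h $ k *\<^sub>R axis k 1)"
    using basis_expansion[of h] by (simp add: scalar_mult_eq_scaleR)
  then show ?thesis
    by (simp add: linear_sum[OF assms] linear_cmul[OF assms])
qed

lemma abs_sum_vec_nth_mult_le:
  fixes h :: "real^'n"
  shows "\<bar>\<Sum>k\<in>UNIV. h $ k * c k\<bar> \<le> norm h * (\<Sum>k\<in>UNIV. \<bar>c k\<bar>)"
proof -
  have "\<bar>\<Sum>k\<in>UNIV. h $ k * c k\<bar> \<le> (\<Sum>k\<in>UNIV. \<bar>h $ k\<bar> * \<bar>c k\<bar>)"
    using sum_abs[of "\<lambda>k. h $ k * c k"] by (simp add: abs_mult)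
  also have "\<dots> \<le> (\<Sum>k\<in>UNIV. norm h * \<bar>c k\<bar>)"
    by (intro sum_mono mult_right_mono component_le_norm_cart) simp
  finally show ?thesis by (simp add: sum_distrib_left)
qed

text \<open>The analytic core, freed from the geometry: \<open>p\<close> is the gradient of
  \<open>v\<close>, \<open>A\<close> holds the coefficients of an operator in divergence form, and
  the last assumption is the equation combined with the Lipschitz condition. By \<open>pN\<close>,
  the product of \<open>e\<close> and \<open>N\<close> is 1 wherever the derivative along
  \<open>e\<close> is nonzero; the first part of \<open>nz\<close> is what controls it where that
  derivative vanishes, which is the case of interest. The second part says that \<open>N\<close> is
  not characteristic for the operator.\<close>

lemma local_unique_continuation:
  fixes v :: "real^'n \<Rightarrow> real" and p N :: "'n \<Rightarrow> real^'n \<Rightarrow> real"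
    and A :: "'n \<Rightarrow> 'n \<Rightarrow> real^'n \<Rightarrow> real" and e :: "real^'n"
  assumes D: "open D" "x0 \<in> D"
    and v: "\<And>x. x \<in> D \<Longrightarrow> (v has_derivative (\<lambda>h. \<Sum>j\<in>UNIV. h $ j * p j x)) (at x)"
    and p: "\<And>j. Ck_on (Suc 0) D (p j)"
    and N: "\<And>j. Ck_on (Suc 0) D (N j)"
    and A: "\<And>i j. Ck_on (Suc 0) D (A i j)"
    and pN: "\<And>i x. x \<in> D \<Longrightarrow> p i x = (\<Sum>j\<in>UNIV. e $ j * p j x) * N i x"
    and nz: "(\<Sum>i\<in>UNIV. e $ i * N i x0) \<noteq> 0"
      "(\<Sum>i\<in>UNIV. \<Sum>j\<in>UNIV. A i j x0 * N i x0 * N j x0) \<noteq> 0"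
    and C: "0 \<le> C"
      "\<And>x. x \<in> D \<Longrightarrow> \<bar>\<Sum>i\<in>UNIV. frechet_derivative (\<lambda>y. \<Sum>j\<in>UNIV. A i j y * p j y) (at x) (axis i 1)\<bar>
          \<le> C * \<bar>v x\<bar>"
  shows "\<exists>r>0. ball x0 r \<subseteq> D \<and>
    (\<forall>x1\<in>ball x0 r. v x1 = 0 \<and> (\<forall>j. p j x1 = 0) \<longrightarrow> (\<forall>x\<in>ball x0 r. v x = 0))"
proof -
  have "\<forall>j. \<exists>p'. (\<forall>x\<in>D. (p j has_derivative p' x) (at x)) \<and> (\<forall>k. continuous_on D (\<lambda>x. p' x k))"
    using p unfolding Ck_on_1_iff[OF D(1)] by blast
  then obtain p' where p': "\<And>j x. x \<in> D \<Longrightarrow> (p j has_derivative p' j x) (at x)"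
    "\<And>j k. continuous_on D (\<lambda>x. p' j x k)"
    using choice[of "\<lambda>j p'. (\<forall>x\<in>D. (p j has_derivative p' x) (at x)) \<and> (\<forall>k. continuous_on D (\<lambda>x. p' x k))"]
    by blast
  have "\<forall>j. \<exists>p'. (\<forall>x\<in>D. (N j has_derivative p' x) (at x)) \<and> (\<forall>k. continuous_on D (\<lambda>x. p' x k))"
    using N unfolding Ck_on_1_iff[OF D(1)] by blast
  then obtain N' where N': "\<And>j x. x \<in> D \<Longrightarrow> (N j has_derivative N' j x) (at x)"
    "\<And>j k. continuous_on D (\<lambda>x. N' j x k)"
    using choice[of "\<lambda>j p'. (\<forall>x\<in>D. (N j has_derivative p' x) (at x)) \<and> (\<forall>k. continuous_on D (\<lambda>x. p' x k))"]
    by blast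
  \<comment> \<open>The two indices are packed into a pair so that a single use of
    \<open>choice\<close> suffices.\<close>
  have "\<forall>ij. \<exists>p'. (\<forall>x\<in>D. (A (fst ij) (snd ij) has_derivative p' x) (at x)) \<and> (\<forall>k. continuous_on D (\<lambda>x. p' x k))"
    using A unfolding Ck_on_1_iff[OF D(1)] by blast
  then obtain A0 where A0: "\<And>ij x. x \<in> D \<Longrightarrow> (A (fst ij) (snd ij) has_derivative A0 ij x) (at x)"
    "\<And>ij k. continuous_on D (\<lambda>x. A0 ij x k)"
    using choice[of "\<lambda>ij p'. (\<forall>x\<in>D. (A (fst ij) (snd ij) has_derivative p' x) (at x)) \<and> (\<forall>k. continuous_on D (\<lambda>x. p' x k))"]
    by blast
  define A' where "A' = (\<lambda>i j. A0 (i, j))"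
  have A': "\<And>i j x. x \<in> D \<Longrightarrow> (A i j has_derivative A' i j x) (at x)"
    "\<And>i j k. continuous_on D (\<lambda>x. A' i j x k)"
    unfolding A'_def using A0(1)[of _ "(_, _)"] A0(2) by auto
  note cont = p[THEN Ck_on_1_imp_continuous_on] N[THEN Ck_on_1_imp_continuous_on]
    A[THEN Ck_on_1_imp_continuous_on] p'(2) N'(2) A'(2)

  \<comment> \<open>The last index of \<open>P\<close>, \<open>Nd\<close> and \<open>Ad\<close> is
    the direction of differentiation, so \<open>P\<close> is the Hessian of \<open>v\<close>, and
    \<open>dl\<close> is the gradient of \<open>l\<close>. The quantity \<open>dv\<close> is the
    divergence bounded by the equation.\<close>
  define P where "P = (\<lambda>j k x. p' j x (axis k 1))"
  define Nd where "Nd = (\<lambda>j k x. N' j x (axis k 1))"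
  define Ad where "Ad = (\<lambda>i j k x. A' i j x (axis k 1))"
  define l where "l = (\<lambda>x. \<Sum>j\<in>UNIV. e $ j * p j x)"
  define dl where "dl = (\<lambda>k x. \<Sum>j\<in>UNIV. e $ j * P j k x)"
  define \<nu> where "\<nu> = (\<lambda>x. \<Sum>i\<in>UNIV. e $ i * N i x)"
  define Q where "Q = (\<lambda>x. \<Sum>i\<in>UNIV. \<Sum>j\<in>UNIV. A i j x * N i x * N j x)"
  \<comment> \<open>\<open>c\<close> is the curl of \<open>N\<close> contracted with
    \<open>e\<close>, the error made when the indices of the Hessian are exchanged. \<open>R\<close>
    collects everything that multiplies \<open>l\<close> once the divergence has been multiplied by
    \<open>\<nu>\<close>.\<close>
  define c where "c = (\<lambda>k x. \<Sum>i\<in>UNIV. e $ i * Nd k i x - e $ i * Nd i k x)"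
  define R where "R = (\<lambda>x. \<Sum>i\<in>UNIV. \<Sum>j\<in>UNIV.
      A i j x * N j x * c i x + (Ad i j i x * N j x + A i j x * Nd j i x) * \<nu> x)"
  define dv where "dv = (\<lambda>x. \<Sum>i\<in>UNIV. \<Sum>j\<in>UNIV. Ad i j i x * p j x + A i j x * P j i x)"
  have cont': "continuous_on D \<nu>" "continuous_on D Q" "continuous_on D (c k)" "continuous_on D R" for k
    unfolding \<nu>_def Q_def c_def R_def Nd_def Ad_def using cont
    by (auto intro!: continuous_intros simp del: Ck_on.simps)

  have dv: "(\<Sum>i\<in>UNIV. frechet_derivative (\<lambda>y. \<Sum>j\<in>UNIV. A i j y * p j y) (at x) (axis i 1)) = dv x"
    if "x \<in> D" for x
  proof -
    have "((\<lambda>y. \<Sum>j\<in>UNIV. A i j y * p j y) has_derivative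
        (\<lambda>h. \<Sum>j\<in>UNIV. A i j x * p' j x h + A' i j x h * p j x)) (at x)" for i
      by (intro has_derivative_sum has_derivative_mult A'(1) p'(1) that)
    from frechet_derivative_at[OF this, symmetric] show ?thesis
      unfolding dv_def P_def Ad_def by (simp add: add.commute)
  qed
  have pl: "p i x = l x * N i x" if "x \<in> D" for i x
    using pN[OF that] unfolding l_def .
  have l': "(l has_derivative (\<lambda>h. \<Sum>j\<in>UNIV. e $ j * p' j x h)) (at x)" if "x \<in> D" for x
    unfolding l_def by (intro has_derivative_sum has_derivative_mult_right p'(1) that)
  have l'_eq: "(\<Sum>j\<in>UNIV. e $ j * p' j x h) = (\<Sum>k\<in>UNIV. h $ k * dl k x)" if "x \<in> D" for x h
    using linear_axis_expansion[OF has_derivative_linear[OF l'[OF that]], of h]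
    unfolding dl_def P_def by simp
  have P: "P i k x = dl k x * N i x + l x * Nd i k x" if "x \<in> D" for i k x
  proof -
    have "((\<lambda>y. l y * N i y) has_derivative
        (\<lambda>h. l x * N' i x h + (\<Sum>j\<in>UNIV. e $ j * p' j x h) * N i x)) (at x)"
      by (intro has_derivative_mult l' N'(1) that)
    then have "(p i has_derivative (\<lambda>h. l x * N' i x h + (\<Sum>j\<in>UNIV. e $ j * p' j x h) * N i x)) (at x)"
      by (rule has_derivative_transform_within_open[OF _ D(1) that]) (simp add: pl)
    from has_derivative_unique[OF p'(1)[OF that] this] show ?thesis
      unfolding P_def dl_def Nd_def by simp
  qed
  have sym: "P i k x = P k i x" if "x \<in> D" for i k x
  proof -
    have *: "(\<lambda>y. \<Sum>j\<in>UNIV. axis i 1 $ j * p j y) = p i" for i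
      by (simp add: axis_def if_distrib[of "\<lambda>z. z * _"] cong: if_cong)
    show ?thesis
      unfolding P_def
      using second_derivative_symmetric[OF D(1) that v, of "axis i 1" "p' i" "axis k 1" "p' k"]
        p' unfolding * by blast
  qed
  \<comment> \<open>Differentiating \<open>p i = l * N i\<close> gives two expressions for each
    Hessian entry. Weighting their equality by \<open>e $ i\<close> and summing leaves the
    derivative of \<open>l\<close> along \<open>e\<close> as the only unknown.\<close>
  have dl_\<nu>: "dl k x * \<nu> x = (\<Sum>i\<in>UNIV. e $ i * dl i x) * N k x + l x * c k x" if "x \<in> D" for k x
  proof -
    have "e $ i * (dl k x * N i x) =
        e $ i * dl i x * N k x + l x * (e $ i * Nd k i x - e $ i * Nd i k x)" for i
    proof -
      have "dl k x * N i x + l x * Nd i k x = dl i x * N k x + l x * Nd k i x"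
        using sym[OF that, of i k] by (simp only: P[OF that])
      then have "e $ i * (dl k x * N i x + l x * Nd i k x) = e $ i * (dl i x * N k x + l x * Nd k i x)"
        by simp
      then show ?thesis by (simp only: algebra_simps)
    qed
    then have "(\<Sum>i\<in>UNIV. e $ i * (dl k x * N i x)) =
        (\<Sum>i\<in>UNIV. e $ i * dl i x * N k x + l x * (e $ i * Nd k i x - e $ i * Nd i k x))"
      by (simp only:)
    also have "\<dots> = (\<Sum>i\<in>UNIV. e $ i * dl i x) * N k x + l x * c k x"
      unfolding c_def by (simp only: sum.distrib sum_distrib_left sum_distrib_right)
    finally show ?thesis
      unfolding \<nu>_def by (simp only: sum_distrib_left mult.left_commute)
  qed
  \<comment> \<open>The factor \<open>\<nu>\<close> allows \<open>dl_\<nu>\<close> to be substituted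
    without division; the second-order terms then assemble into \<open>Q\<close>.\<close>
  have dv_\<nu>: "dv x * \<nu> x = (\<Sum>i\<in>UNIV. e $ i * dl i x) * Q x + l x * R x" if "x \<in> D" for x
  proof -
    have "(Ad i j i x * p j x + A i j x * P j i x) * \<nu> x =
        (\<Sum>i\<in>UNIV. e $ i * dl i x) * (A i j x * N i x * N j x) +
        l x * (A i j x * N j x * c i x + (Ad i j i x * N j x + A i j x * Nd j i x) * \<nu> x)" for i j
    proof -
      have "(Ad i j i x * p j x + A i j x * P j i x) * \<nu> x =
          A i j x * N j x * (dl i x * \<nu> x) + l x * ((Ad i j i x * N j x + A i j x * Nd j i x) * \<nu> x)"
        unfolding P[OF that] pl[OF that] by (simp only: algebra_simps)
      then show ?thesis
        unfolding dl_\<nu>[OF that] by (simp only: algebra_simps)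
    qed
    then show ?thesis
      unfolding dv_def Q_def R_def
      by (simp only: sum_distrib_left sum_distrib_right sum.distrib flip: sum.distrib)
  qed

  \<comment> \<open>These coefficients come from solving \<open>dv_\<nu>\<close> for the derivative
    of \<open>l\<close> along \<open>e\<close> and inserting the result into
    \<open>dl_\<nu>\<close>.\<close>
  define \<alpha> where "\<alpha> = (\<lambda>k x. N k x / Q x)"
  define \<beta> where "\<beta> = (\<lambda>k x. (c k x - R x * N k x / Q x) / \<nu> x)"
  have dl_eq: "dl k x = dv x * \<alpha> k x + l x * \<beta> k x" if "x \<in> D" "\<nu> x \<noteq> 0" "Q x \<noteq> 0" for k x
  proof -
    have "(\<Sum>i\<in>UNIV. e $ i * dl i x) = (dv x * \<nu> x - l x * R x) / Q x"
      using dv_\<nu>[OF that(1)] that(3) by (simp add: field_simps)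
    then have "dl k x = ((dv x * \<nu> x - l x * R x) / Q x * N k x + l x * c k x) / \<nu> x"
      using dl_\<nu>[OF that(1), of k] that(2) by (simp add: field_simps)
    also have "\<dots> = dv x * \<alpha> k x + l x * \<beta> k x"
      unfolding \<alpha>_def \<beta>_def using that(2,3) by (simp add: field_simps)
    finally show ?thesis .
  qed

  \<comment> \<open>Both denominators are nonzero at \<open>x0\<close>, hence on a closed ball
    around it, whose compactness bounds all coefficients at once.\<close>
  define D1 where "D1 = {x \<in> D. \<nu> x \<noteq> 0 \<and> Q x \<noteq> 0}"
  have "D1 = (D \<inter> \<nu> -` (-{0})) \<inter> (D \<inter> Q -` (-{0}))" unfolding D1_def by auto
  then have "open D1"
    using continuous_open_preimage[OF cont'(1) D(1)] continuous_open_preimage[OF cont'(2) D(1)]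
    by (metis closed_singleton open_Compl open_Int)
  moreover have "x0 \<in> D1" using nz D unfolding D1_def \<nu>_def Q_def by simp
  ultimately obtain r where r: "r > 0" "cball x0 r \<subseteq> D1"
    using open_contains_cball by blast
  then have rD: "ball x0 r \<subseteq> D" "cball x0 r \<subseteq> D"
    using ball_subset_cball[of x0 r] unfolding D1_def by blast+
  have c_on: "continuous_on (cball x0 r) f" if "continuous_on D f" for f :: "real^'n \<Rightarrow> real"
    using continuous_on_subset[OF that rD(2)] .
  have "continuous_on (cball x0 r) (\<lambda>x. \<Sum>k\<in>UNIV. \<bar>\<alpha> k x\<bar> + \<bar>\<beta> k x\<bar> + \<bar>N k x\<bar>)"
    unfolding \<alpha>_def \<beta>_def
    using r(2) by (intro continuous_intros c_on cont cont') (auto simp: D1_def)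
  then have "bounded ((\<lambda>x. \<Sum>k\<in>UNIV. \<bar>\<alpha> k x\<bar> + \<bar>\<beta> k x\<bar> + \<bar>N k x\<bar>) ` cball x0 r)"
    by (intro compact_imp_bounded compact_continuous_image) auto
  then obtain B where B: "\<And>x. x \<in> cball x0 r \<Longrightarrow> \<bar>\<Sum>k\<in>UNIV. \<bar>\<alpha> k x\<bar> + \<bar>\<beta> k x\<bar> + \<bar>N k x\<bar>\<bar> \<le> B"
    unfolding bounded_iff real_norm_def by blast
  have "B \<ge> 0" using B[of x0] r(1) by simp
  have B': "(\<Sum>k\<in>UNIV. \<bar>\<alpha> k x\<bar>) \<le> B" "(\<Sum>k\<in>UNIV. \<bar>\<beta> k x\<bar>) \<le> B" "(\<Sum>k\<in>UNIV. \<bar>N k x\<bar>) \<le> B"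
    if "x \<in> ball x0 r" for x
  proof -
    have "(\<Sum>k\<in>UNIV. \<bar>\<alpha> k x\<bar>) + (\<Sum>k\<in>UNIV. \<bar>\<beta> k x\<bar>) + (\<Sum>k\<in>UNIV. \<bar>N k x\<bar>) \<le> B"
      using B[of x] that by (simp add: sum.distrib)
    moreover have "0 \<le> (\<Sum>k\<in>UNIV. \<bar>\<alpha> k x\<bar>)" "0 \<le> (\<Sum>k\<in>UNIV. \<bar>\<beta> k x\<bar>)" "0 \<le> (\<Sum>k\<in>UNIV. \<bar>N k x\<bar>)"
      by (auto intro: sum_nonneg)
    ultimately show "(\<Sum>k\<in>UNIV. \<bar>\<alpha> k x\<bar>) \<le> B" "(\<Sum>k\<in>UNIV. \<bar>\<beta> k x\<bar>) \<le> B" "(\<Sum>k\<in>UNIV. \<bar>N k x\<bar>) \<le> B"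
      by linarith+
  qed
  \<comment> \<open>Chosen to dominate both \<open>B\<close>, which bounds the coefficients, and
    \<open>B * C\<close>, which appears when \<open>dv\<close> is replaced by its bound.\<close>
  define K where "K = B * (C + 1)"
  have "K \<ge> 0" "B \<le> K" "B * C \<le> K"
    using \<open>B \<ge> 0\<close> C(1) unfolding K_def by (auto simp: algebra_simps)
  have v_bound: "\<bar>\<Sum>j\<in>UNIV. h $ j * p j x\<bar> \<le> K * norm h * \<bar>l x\<bar>" if "x \<in> ball x0 r" for x h
  proof -
    have "(\<Sum>j\<in>UNIV. \<bar>p j x\<bar>) = \<bar>l x\<bar> * (\<Sum>j\<in>UNIV. \<bar>N j x\<bar>)"
      using pl[of x] that rD by (auto simp: abs_mult sum_distrib_left)
    also have "\<dots> \<le> \<bar>l x\<bar> * K"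
      using B'(3)[OF that] \<open>B \<le> K\<close> by (intro mult_left_mono) auto
    finally have "norm h * (\<Sum>j\<in>UNIV. \<bar>p j x\<bar>) \<le> norm h * (\<bar>l x\<bar> * K)"
      by (intro mult_left_mono) auto
    then show ?thesis
      using abs_sum_vec_nth_mult_le[of h "\<lambda>j. p j x"] by (simp add: mult_ac)
  qed
  have l_bound: "\<bar>\<Sum>j\<in>UNIV. e $ j * p' j x h\<bar> \<le> K * norm h * (\<bar>v x\<bar> + \<bar>l x\<bar>)" if "x \<in> ball x0 r" for x h
  proof -
    have xD: "x \<in> D" "\<nu> x \<noteq> 0" "Q x \<noteq> 0"
      using subsetD[OF r(2), of x] that unfolding D1_def by auto
    have "\<bar>dl k x\<bar> \<le> C * \<bar>v x\<bar> * \<bar>\<alpha> k x\<bar> + \<bar>l x\<bar> * \<bar>\<beta> k x\<bar>" for k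
    proof -
      have "\<bar>dl k x\<bar> \<le> \<bar>dv x\<bar> * \<bar>\<alpha> k x\<bar> + \<bar>l x\<bar> * \<bar>\<beta> k x\<bar>"
        unfolding dl_eq[OF xD] by (metis abs_mult abs_triangle_ineq)
      moreover have "\<bar>dv x\<bar> * \<bar>\<alpha> k x\<bar> \<le> C * \<bar>v x\<bar> * \<bar>\<alpha> k x\<bar>"
        using C(2)[OF xD(1)] dv[OF xD(1)] by (intro mult_right_mono) auto
      ultimately show ?thesis by linarith
    qed
    then have "(\<Sum>k\<in>UNIV. \<bar>dl k x\<bar>) \<le> (\<Sum>k\<in>UNIV. C * \<bar>v x\<bar> * \<bar>\<alpha> k x\<bar> + \<bar>l x\<bar> * \<bar>\<beta> k x\<bar>)"
      by (intro sum_mono) auto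
    also have "\<dots> = C * \<bar>v x\<bar> * (\<Sum>k\<in>UNIV. \<bar>\<alpha> k x\<bar>) + \<bar>l x\<bar> * (\<Sum>k\<in>UNIV. \<bar>\<beta> k x\<bar>)"
      by (simp only: sum.distrib sum_distrib_left)
    also have "\<dots> \<le> C * \<bar>v x\<bar> * B + \<bar>l x\<bar> * B"
      using B'[OF that] C(1) by (intro add_mono mult_left_mono) auto
    also have "\<dots> = B * C * \<bar>v x\<bar> + B * \<bar>l x\<bar>" by (simp only: mult_ac)
    also have "\<dots> \<le> K * \<bar>v x\<bar> + K * \<bar>l x\<bar>"
      using \<open>B \<le> K\<close> \<open>B * C \<le> K\<close> by (intro add_mono mult_right_mono) auto
    finally have "norm h * (\<Sum>k\<in>UNIV. \<bar>dl k x\<bar>) \<le> norm h * (K * \<bar>v x\<bar> + K * \<bar>l x\<bar>)"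
      by (intro mult_left_mono) auto
    then show ?thesis
      using abs_sum_vec_nth_mult_le[of h "\<lambda>k. dl k x"] unfolding l'_eq[OF xD(1)]
      by (simp add: algebra_simps)
  qed
  have "v x = 0" if *: "x1 \<in> ball x0 r" "v x1 = 0" "\<forall>j. p j x1 = 0" "x \<in> ball x0 r" for x1 x
    by (rule vanish_on_ball[OF v l' \<open>K \<ge> 0\<close> v_bound l_bound *(1,2) _ *(4)])
      (use rD *(3) in \<open>auto simp: l_def\<close>)
  then show ?thesis using r(1) rD(1) by blast
qed

section \<open>Polar actions\<close>

lemma is_chartD:
  assumes "is_chart H (U, \<phi>)"
  shows "open U" "openin (top_of_set H) (\<phi> ` U)" "continuous_on U \<phi>"
    "continuous_on (\<phi> ` U) (inv_into U \<phi>)" "inj_on \<phi> U"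
    "\<And>x. x \<in> U \<Longrightarrow> inv_into U \<phi> (\<phi> x) = x" "\<And>y. y \<in> \<phi> ` U \<Longrightarrow> \<phi> (inv_into U \<phi> y) = y"
    "\<And>y. y \<in> \<phi> ` U \<Longrightarrow> inv_into U \<phi> y \<in> U"
proof -
  have h: "homeomorphism U (\<phi> ` U) \<phi> (inv_into U \<phi>)"
    using assms unfolding is_chart_def by simp
  show inv: "\<And>x. x \<in> U \<Longrightarrow> inv_into U \<phi> (\<phi> x) = x"
    using homeomorphism_apply1[OF h] .
  show "inj_on \<phi> U" by (rule inj_on_inverseI[of _ "inv_into U \<phi>"]) (rule inv)
  show "continuous_on U \<phi>" "continuous_on (\<phi> ` U) (inv_into U \<phi>)"
    using h unfolding homeomorphism_def by auto
  show "open U" "openin (top_of_set H) (\<phi> ` U)"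
    using assms unfolding is_chart_def by auto
qed (auto intro: f_inv_into_f inv_into_into)

lemma smooth_mapD:
  assumes "smooth_map A B F" "(U, \<phi>) \<in> A" "(V, \<psi>) \<in> B"
  shows "continuous_on U F" "smooth_on (\<phi> ` (U \<inter> F -` V)) (\<psi> \<circ> F \<circ> inv_into U \<phi>)"
  using assms unfolding smooth_map_def by blast+

lemma smooth_manifold_chartE:
  assumes "smooth_manifold H A"
  obtains U \<phi> where "(U, \<phi>) \<in> A" "x \<in> U"
proof -
  have "x \<in> (\<Union>(U, \<phi>)\<in>A. U)"
    using assms unfolding smooth_manifold_def by (metis UNIV_I)
  then show thesis using that by blast
qed

lemma (in polar_setting) chart_M: "(U, \<phi>) \<in> AM \<Longrightarrow> is_chart half_space (U, \<phi>)"
  using manifold_M unfolding smooth_manifold_def by blast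

text \<open>\<open>bdry\<close> collects the points that some chart sends to the frontier of the
  half-space, so a point outside it avoids the frontier in every chart; no invariance of the
  boundary under change of charts enters. Relative openness of the chart image does the
  rest.\<close>

lemma (in polar_setting) regular_interior:
  assumes "(U, \<phi>) \<in> AM" "x \<in> U" "x \<in> regular_points AM G act"
  shows "\<phi> x \<in> interior (\<phi> ` U)"
proof -
  have "\<phi> x \<notin> frontier half_space"
    using assms unfolding regular_points_def bdry_def by auto
  moreover obtain W where W: "open W" "\<phi> ` U = half_space \<inter> W"
    using is_chartD(2)[OF chart_M[OF assms(1)]] unfolding openin_open by blast
  moreover have "\<phi> x \<in> \<phi> ` U" using assms(2) by simp
  ultimately have "\<phi> x \<in> interior half_space \<inter> W"
    unfolding frontier_def using closure_subset[of half_space] by auto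
  then show ?thesis
    unfolding W(2) interior_Int using W(1) by (simp add: interior_open)
qed

text \<open>The vector fields \<open>Y j\<close> are fundamental vector fields of the action, read in the chart; they
  are tangent to the orbits. The vector \<open>e\<close> is tangent to the section.\<close>

lemma (in polar_setting) orbit_fields:
  assumes s: "s \<in> regular_params AM G act \<iota>" and c: "(U, \<phi>) \<in> AM" "\<iota> s \<in> U"
  shows "\<exists>(e :: real^'n) (a :: real^'n) Y.
    (\<forall>j. Ck_on (Suc 0) (interior (\<phi> ` U)) (Y j)) \<and>
    (\<forall>j. axis j 1 = a $ j *\<^sub>R e + Y j (\<phi> (\<iota> s))) \<and> a \<bullet> e = 1 \<and>
    (\<forall>u x j. radial G act u \<longrightarrow> x \<in> interior (\<phi> ` U) \<longrightarrow>
      (u \<circ> inv_into U \<phi>) differentiable (at x) \<longrightarrow>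
      frechet_derivative (u \<circ> inv_into U \<phi>) (at x) (Y j x) = 0)"
proof -
  define D where "D = interior (\<phi> ` U)"
  define \<psi> where "\<psi> = inv_into U \<phi>"
  define x0 where "x0 = \<phi> (\<iota> s)"
  note chM = is_chartD[OF chart_M[OF c(1)], folded \<psi>_def]
  have "open D" "D \<subseteq> \<phi> ` U" unfolding D_def by (auto simp: interior_subset)
  have x0: "x0 \<in> D" "\<psi> x0 = \<iota> s"
    using regular_interior[OF c] s chM(6)[OF c(2)] unfolding x0_def D_def regular_params_def by auto
  obtain N \<theta> where d: "(N, \<theta>) \<in> AN" "s \<in> N"
    by (rule smooth_manifold_chartE[OF manifold_N])
  have "smooth_manifold UNIV AG" using lie_group unfolding lie_group_def by blast
  then obtain V \<xi> where b: "(V, \<xi>) \<in> AG" "\<one>\<^bsub>G\<^esub> \<in> V"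
    by (rule smooth_manifold_chartE)
  have "is_chart UNIV (V, \<xi>)"
    using lie_group b(1) unfolding lie_group_def smooth_manifold_def by blast
  note chG = is_chartD[OF this]
  define \<zeta> where "\<zeta> = inv_into V \<xi>"
  define \<eta>0 where "\<eta>0 = \<xi> \<one>\<^bsub>G\<^esub>"
  note chG = chG[folded \<zeta>_def]
  have "open (\<xi> ` V)" using chG(2) by simp
  have \<eta>0: "\<eta>0 \<in> \<xi> ` V" "\<zeta> \<eta>0 = \<one>\<^bsub>G\<^esub>"
    using b(2) chG(6) unfolding \<eta>0_def by auto
  have UNIV_G: "carrier G = UNIV" using lie_group unfolding lie_group_def by blast
  have act_one: "act \<one>\<^bsub>G\<^esub> x = x" for x
    using group_action.id_eq_one[OF action] by (metis restrict_UNIV)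

  \<comment> \<open>The action in coordinates, on the open set \<open>T\<close> of pairs whose image
    stays in the chart of the manifold.\<close>
  define F where "F = (\<lambda>z. \<phi> (act (\<zeta> (fst z)) (\<psi> (snd z))))"
  define T where "T = {z \<in> \<xi> ` V \<times> D. act (\<zeta> (fst z)) (\<psi> (snd z)) \<in> U}"
  have prod_chart: "(V \<times> U, map_prod \<xi> \<phi>) \<in> prod_atlas AG AM"
    unfolding prod_atlas_def using b(1) c(1) by force
  have sm: "continuous_on (V \<times> U) (\<lambda>(a, x). act a x)"
    "smooth_on (map_prod \<xi> \<phi> ` (V \<times> U \<inter> (\<lambda>(a, x). act a x) -` U))
      (\<phi> \<circ> (\<lambda>(a, x). act a x) \<circ> inv_into (V \<times> U) (map_prod \<xi> \<phi>))"
    by (rule smooth_mapD[OF smooth_action prod_chart c(1)])+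
  have inv_prod: "inv_into (V \<times> U) (map_prod \<xi> \<phi>) z = (\<zeta> (fst z), \<psi> (snd z))"
    if "z \<in> \<xi> ` V \<times> \<phi> ` U" for z
  proof (rule inv_into_f_eq)
    show "inj_on (map_prod \<xi> \<phi>) (V \<times> U)"
      using chG(5) chM(5) by (rule map_prod_inj_on)
  qed (use that chG(7,8) chM(7,8) in auto)
  have "open T"
  proof -
    have "continuous_on (\<xi> ` V \<times> D) (\<lambda>z. (\<zeta> (fst z), \<psi> (snd z)))"
      using \<open>D \<subseteq> \<phi> ` U\<close>
      by (intro continuous_intros continuous_on_compose2[OF chG(4)] continuous_on_compose2[OF chM(4)]) auto
    moreover have "(\<lambda>z. (\<zeta> (fst z), \<psi> (snd z))) ` (\<xi> ` V \<times> D) \<subseteq> V \<times> U"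
      using chG(8) chM(8) \<open>D \<subseteq> \<phi> ` U\<close> by (auto simp: subset_iff)
    ultimately have "continuous_on (\<xi> ` V \<times> D) (\<lambda>z. act (\<zeta> (fst z)) (\<psi> (snd z)))"
      using continuous_on_compose2[OF sm(1)] by fastforce
    from continuous_open_preimage[OF this open_Times[OF \<open>open (\<xi> ` V)\<close> \<open>open D\<close>] chM(1)]
    show ?thesis unfolding T_def by (simp add: Int_def vimage_def)
  qed
  have T0: "(\<eta>0, x) \<in> T" if "x \<in> D" for x
    using that \<eta>0 act_one chM(8) \<open>D \<subseteq> \<phi> ` U\<close> unfolding T_def by auto
  have F0: "F (\<eta>0, x) = x" if "x \<in> D" for x
    using that \<eta>0 act_one chM(7) \<open>D \<subseteq> \<phi> ` U\<close> unfolding F_def by auto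
  have F: "Ck_on (Suc (Suc 0)) T F"
  proof -
    have "T \<subseteq> map_prod \<xi> \<phi> ` (V \<times> U \<inter> (\<lambda>(a, x). act a x) -` U)"
    proof
      fix z assume z: "z \<in> T"
      then have "z = map_prod \<xi> \<phi> (\<zeta> (fst z), \<psi> (snd z))"
        using chG(7) chM(7) \<open>D \<subseteq> \<phi> ` U\<close> unfolding T_def by (auto simp: prod_eq_iff)
      moreover have "(\<zeta> (fst z), \<psi> (snd z)) \<in> V \<times> U \<inter> (\<lambda>(a, x). act a x) -` U"
        using z chG(8) chM(8) \<open>D \<subseteq> \<phi> ` U\<close> unfolding T_def by auto
      ultimately show "z \<in> map_prod \<xi> \<phi> ` (V \<times> U \<inter> (\<lambda>(a, x). act a x) -` U)"
        by (rule image_eqI)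
    qed
    then have "Ck_on (Suc (Suc 0)) T (\<phi> \<circ> (\<lambda>(a, x). act a x) \<circ> inv_into (V \<times> U) (map_prod \<xi> \<phi>))"
      using sm(2) \<open>open T\<close> Ck_on_open_subset unfolding smooth_on_def by blast
    moreover have "(\<phi> \<circ> (\<lambda>(a, x). act a x) \<circ> inv_into (V \<times> U) (map_prod \<xi> \<phi>)) z = F z" if "z \<in> T" for z
    proof -
      have "z \<in> \<xi> ` V \<times> \<phi> ` U" using that \<open>D \<subseteq> \<phi> ` U\<close> unfolding T_def by auto
      then show ?thesis using inv_prod unfolding F_def by simp
    qed
    ultimately show ?thesis using Ck_on_cong by blast
  qed
  \<comment> \<open>The group-direction derivative of \<open>F\<close> at the identity; two
    derivatives of \<open>F\<close> make this field C1 in \<open>x\<close>.\<close>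
  define X where "X = (\<lambda>h x. frechet_derivative F (at (\<eta>0, x)) (h, 0))"
  have X_C1: "Ck_on (Suc 0) D (X h)" for h
    unfolding X_def by (rule Ck_on_1_slice[OF \<open>open T\<close> Ck_on_2_open(2)[OF \<open>open T\<close> F] \<open>open D\<close> T0])
  have F_deriv: "((\<lambda>\<eta>. F (\<eta>, x)) has_derivative (\<lambda>h. X h x)) (at \<eta>0)" if "x \<in> D" for x
  proof -
    have "((\<lambda>\<eta>. (\<eta>, x)) has_derivative (\<lambda>h. (h, 0))) (at \<eta>0)"
      by (auto intro!: derivative_eq_intros)
    from has_derivative_compose[OF this Ck_on_2_open(1)[OF \<open>open T\<close> F T0[OF that]]]
    show ?thesis unfolding X_def .
  qed
  have open_slice: "open {\<eta>. (\<eta>, x) \<in> T}" for x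
    using open_vimage[OF \<open>open T\<close>, of "\<lambda>\<eta>. (\<eta>, x)"]
    by (simp add: vimage_def continuous_on_Pair)
  have X_radial: "frechet_derivative (u \<circ> \<psi>) (at x) (X h x) = 0"
    if u: "radial G act u" and x: "x \<in> D" and diff: "(u \<circ> \<psi>) differentiable (at x)" for u x h
  proof -
    have "((u \<circ> \<psi>) has_derivative frechet_derivative (u \<circ> \<psi>) (at x)) (at (F (\<eta>0, x)))"
      using diff F0[OF x] by (simp flip: frechet_derivative_works)
    from has_derivative_compose[OF F_deriv[OF x] this]
    have "((\<lambda>\<eta>. (u \<circ> \<psi>) (F (\<eta>, x))) has_derivative
        (\<lambda>h. frechet_derivative (u \<circ> \<psi>) (at x) (X h x))) (at \<eta>0)" .
    \<comment> \<open>By radiality the function of \<open>\<eta>\<close> is constant near the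
      identity, so its chain-rule derivative must vanish.\<close>
    moreover have "((\<lambda>\<eta>. (u \<circ> \<psi>) (F (\<eta>, x))) has_derivative (\<lambda>h. 0)) (at \<eta>0)"
    proof (rule has_derivative_transform_within_open[OF has_derivative_const open_slice])
      show "\<eta>0 \<in> {\<eta>. (\<eta>, x) \<in> T}" using T0[OF x] by simp
      show "u (\<psi> x) = (u \<circ> \<psi>) (F (\<eta>, x))" if "\<eta> \<in> {\<eta>. (\<eta>, x) \<in> T}" for \<eta>
        using that u chM(6) unfolding T_def F_def radial_def UNIV_G by auto
    qed
    ultimately show ?thesis using has_derivative_unique by metis
  qed

  \<comment> \<open>\<open>polar\<close> speaks of a derivative within a chart image. That set is
    the slice of \<open>T\<close> over \<open>x0\<close>, which is open, so the derivative is that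
    of \<open>F\<close> in the group variable.\<close>
  have T': "coord_deriv (V, \<xi>) (U, \<phi>) (\<lambda>a. act a (\<iota> s)) \<one>\<^bsub>G\<^esub> = (\<lambda>h. X h x0)"
  proof -
    have eq: "\<xi> ` (V \<inter> (\<lambda>a. act a (\<iota> s)) -` U) = {\<eta>. (\<eta>, x0) \<in> T}"
    proof (intro equalityI subsetI)
      fix \<eta> assume "\<eta> \<in> {\<eta>. (\<eta>, x0) \<in> T}"
      then have "\<eta> = \<xi> (\<zeta> \<eta>)" "\<zeta> \<eta> \<in> V \<inter> (\<lambda>a. act a (\<iota> s)) -` U"
        using chG(7,8) x0 unfolding T_def by auto
      then show "\<eta> \<in> \<xi> ` (V \<inter> (\<lambda>a. act a (\<iota> s)) -` U)" by (rule image_eqI)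
    qed (use chG(6) x0 in \<open>auto simp: T_def\<close>)
    have "(\<phi> \<circ> (\<lambda>a. act a (\<iota> s)) \<circ> \<zeta>) = (\<lambda>\<eta>. F (\<eta>, x0))"
      using x0 by (auto simp: F_def)
    then have "coord_deriv (V, \<xi>) (U, \<phi>) (\<lambda>a. act a (\<iota> s)) \<one>\<^bsub>G\<^esub>
        = frechet_derivative (\<lambda>\<eta>. F (\<eta>, x0)) (at \<eta>0 within {\<eta>. (\<eta>, x0) \<in> T})"
      unfolding coord_deriv_def by (simp add: eq flip: \<zeta>_def \<eta>0_def)
    also have "\<dots> = (\<lambda>h. X h x0)"
      using at_within_open[OF _ open_slice, of \<eta>0 x0] T0[OF x0(1)]
        frechet_derivative_at[OF F_deriv[OF x0(1)]] by simp
    finally show ?thesis .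
  qed
  define L where "L = coord_deriv (N, \<theta>) (U, \<phi>) \<iota> s"
  have imm: "smooth_map AN AM \<iota>"
    "\<And>c d x. c \<in> AN \<Longrightarrow> d \<in> AM \<Longrightarrow> x \<in> fst c \<Longrightarrow> \<iota> x \<in> fst d \<Longrightarrow> inj (coord_deriv c d \<iota> x)"
    using immersed(1) unfolding immersion_def by blast+
  \<comment> \<open>The chart image of the section may be part of a half-line, so \<open>L\<close>
    is a derivative within a set. Differentiability must be established first, since only then is
    the chosen \<open>frechet_derivative\<close> linear.\<close>
  have "linear L"
  proof -
    have "smooth_on (\<theta> ` (N \<inter> \<iota> -` U)) (\<phi> \<circ> \<iota> \<circ> inv_into N \<theta>)"
      by (rule smooth_mapD(2)[OF imm(1) d(1) c(1)])
    then have "Ck_on (Suc 0) (\<theta> ` (N \<inter> \<iota> -` U)) (\<phi> \<circ> \<iota> \<circ> inv_into N \<theta>)"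
      unfolding smooth_on_def by (rule spec)
    moreover have "\<theta> s \<in> \<theta> ` (N \<inter> \<iota> -` U)" using d(2) c(2) by blast
    ultimately have "(\<phi> \<circ> \<iota> \<circ> inv_into N \<theta>) differentiable (at (\<theta> s) within \<theta> ` (N \<inter> \<iota> -` U))"
      unfolding Ck_on.simps by blast
    then have "((\<phi> \<circ> \<iota> \<circ> inv_into N \<theta>) has_derivative L) (at (\<theta> s) within \<theta> ` (N \<inter> \<iota> -` U))"
      unfolding L_def coord_deriv_def fst_conv snd_conv by (rule iffD1[OF frechet_derivative_works])
    then show ?thesis by (rule has_derivative_linear)
  qed
  define e where "e = L 1"
  have L: "L t = t *\<^sub>R e" for t
    unfolding e_def using linear_cmul[OF \<open>linear L\<close>, of t 1] by simp
  have "inj L"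
    unfolding L_def using imm(2)[OF d(1) c(1)] d(2) c(2) by simp
  then have "e \<noteq> 0"
    using L injD[of L 0 1] by auto
  have "{v + w | v w. v \<in> range L \<and> w \<in> range (\<lambda>h. X h x0)} = UNIV \<and>
    range L \<inter> range (\<lambda>h. X h x0) = {0}"
    using polar[rule_format, OF s d(1) c(1) b(1)] d(2) c(2) b(2)
    unfolding T' fst_conv Let_def L_def by blast
  then have pol: "{v + w | v w. v \<in> range L \<and> w \<in> range (\<lambda>h. X h x0)} = UNIV"
    "range L \<inter> range (\<lambda>h. X h x0) = {0}" by blast+
  have "\<forall>j. \<exists>th. axis j 1 = fst th *\<^sub>R e + X (snd th) x0"
  proof
    fix j
    have "axis j 1 \<in> {v + w | v w. v \<in> range L \<and> w \<in> range (\<lambda>h. X h x0)}"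
      unfolding pol(1) by simp
    then show "\<exists>th. axis j 1 = fst th *\<^sub>R e + X (snd th) x0"
      using L by auto
  qed
  then obtain th where th: "\<And>j. axis j 1 = fst (th j) *\<^sub>R e + X (snd (th j)) x0"
    by metis
  define a where "a = (\<chi> j. fst (th j))"
  have lin: "linear (\<lambda>h. X h x0)"
    using has_derivative_linear[OF F_deriv[OF x0(1)]] .
  \<comment> \<open>Expanding \<open>e\<close> in the coordinate axes and splitting each axis gives
    \<open>e\<close> as \<open>(a \<bullet> e) *\<^sub>R e\<close> plus an orbit vector. The two
    tangent spaces meet only in 0, so the coefficient is 1.\<close>
  have "a \<bullet> e = 1"
  proof -
    have "e = (\<Sum>j\<in>UNIV. e $ j *\<^sub>R axis j 1)"
      using basis_expansion[of e] by (simp add: scalar_mult_eq_scaleR)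
    also have "\<dots> = (\<Sum>j\<in>UNIV. (e $ j * fst (th j)) *\<^sub>R e + e $ j *\<^sub>R X (snd (th j)) x0)"
      by (subst th) (simp add: scaleR_add_right)
    also have "\<dots> = (\<Sum>j\<in>UNIV. e $ j * fst (th j)) *\<^sub>R e + X (\<Sum>j\<in>UNIV. e $ j *\<^sub>R snd (th j)) x0"
      using linear_sum[OF lin, of "\<lambda>j. e $ j *\<^sub>R snd (th j)" UNIV]
      by (simp add: sum.distrib scaleR_sum_left linear_cmul[OF lin])
    also have "(\<Sum>j\<in>UNIV. e $ j * fst (th j)) = a \<bullet> e"
      unfolding a_def inner_vec_def by (simp add: mult.commute)
    finally have "L (1 - a \<bullet> e) = X (\<Sum>j\<in>UNIV. e $ j *\<^sub>R snd (th j)) x0"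
      unfolding L by (simp add: algebra_simps)
    then have "L (1 - a \<bullet> e) \<in> range L \<inter> range (\<lambda>h. X h x0)" by (metis IntI rangeI)
    then show ?thesis
      using \<open>e \<noteq> 0\<close> unfolding pol(2) L by simp
  qed
  have "axis j 1 = a $ j *\<^sub>R e + X (snd (th j)) x0" for j
    using th[of j] unfolding a_def by simp
  then show ?thesis
    using X_C1 \<open>a \<bullet> e = 1\<close> X_radial unfolding D_def \<psi>_def x0_def
    by (intro exI[of _ e] exI[of _ a] exI[of _ "\<lambda>j. X (snd (th j))"]) blast
qed

section \<open>Solutions read in the interiors of charts\<close>

context polar_setting
begin

lemma C2_continuous:
  assumes "Ck_fun AM 2 UNIV u"
  shows "continuous_on UNIV u"
proof -
  have "isCont u x" for x
  proof -
    obtain U \<phi> where c: "(U, \<phi>) \<in> AM" "x \<in> U"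
      by (rule smooth_manifold_chartE[OF manifold_M])
    note ch = is_chartD[OF chart_M[OF c(1)]]
    have "continuous_on (\<phi> ` U) (u \<circ> inv_into U \<phi>)"
      using assms c(1) Ck_on_2_imp_continuous_on unfolding Ck_fun_def numeral_2_eq_2
      by (metis (no_types, lifting) Int_UNIV_right case_prodD)
    from continuous_on_compose[OF ch(3) this]
    have "continuous_on U u" using ch(6) by (simp cong: continuous_on_cong)
    then show ?thesis using ch(1) c(2) continuous_on_eq_continuous_at by blast
  qed
  then show ?thesis by (simp add: continuous_at_imp_continuous_on)
qed

lemma C2_chart:
  assumes "(U, \<phi>) \<in> AM" "Ck_fun AM 2 UNIV u"
  shows "Ck_on (Suc (Suc 0)) (interior (\<phi> ` U)) (u \<circ> inv_into U \<phi>)"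
proof -
  have "Ck_on (Suc (Suc 0)) (\<phi> ` U) (u \<circ> inv_into U \<phi>)"
    using assms unfolding Ck_fun_def numeral_2_eq_2
    by (metis (no_types, lifting) Int_UNIV_right case_prodD)
  then show ?thesis by (rule Ck_on_open_subset) (auto simp: interior_subset)
qed

text \<open>Only interior points matter below; in this form the zero function is a solution without a
  discussion of one-sided derivatives at the boundary.\<close>

definition interior_solution :: "('m \<Rightarrow> real \<Rightarrow> real) \<Rightarrow> ('m \<Rightarrow> real) \<Rightarrow> bool" where
  "interior_solution f u \<longleftrightarrow> continuous_on UNIV u \<and> radial G act u \<and>
     (\<forall>(U, \<phi>)\<in>AM. Ck_on 2 (interior (\<phi> ` U)) (u \<circ> inv_into U \<phi>) \<and>
        (\<forall>x\<in>U. \<phi> x \<in> interior (\<phi> ` U) \<longrightarrow> laplacian g (U, \<phi>) u x = f x (u x)))"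

lemma interior_solutionD:
  assumes "interior_solution f u"
  shows "continuous_on UNIV u" "radial G act u"
    and "(U, \<phi>) \<in> AM \<Longrightarrow> Ck_on (Suc (Suc 0)) (interior (\<phi> ` U)) (u \<circ> inv_into U \<phi>)"
    and "(U, \<phi>) \<in> AM \<Longrightarrow> x \<in> U \<Longrightarrow> \<phi> x \<in> interior (\<phi> ` U) \<Longrightarrow> laplacian g (U, \<phi>) u x = f x (u x)"
  using assms unfolding interior_solution_def numeral_2_eq_2 by blast+

lemma interior_solutionI:
  assumes "Ck_fun AM 2 UNIV u" "radial G act u" "solution AM g f u"
  shows "interior_solution f u"
proof -
  have "laplacian g (U, \<phi>) u x = f x (u x)" if "(U, \<phi>) \<in> AM" "x \<in> U" for U \<phi> x
    using assms(3) that unfolding solution_def by fastforce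
  then show ?thesis
    using C2_continuous[OF assms(1)] assms(2) C2_chart[OF _ assms(1)]
    unfolding interior_solution_def numeral_2_eq_2 by blast
qed

section \<open>Gradient, Laplacian and metric in coordinates\<close>

lemma grad_coords:
  assumes c: "(U, \<phi>) \<in> AM" and y: "y \<in> interior (\<phi> ` U)"
  shows "grad g (U, \<phi>) u (inv_into U \<phi> y) = matrix_inv (g (U, \<phi>) (inv_into U \<phi> y)) *v
    (\<chi> j. frechet_derivative (u \<circ> inv_into U \<phi>) (at y) (axis j 1))"
proof -
  have "\<phi> (inv_into U \<phi> y) = y"
    using is_chartD(7)[OF chart_M[OF c]] y interior_subset by blast
  then show ?thesis
    unfolding grad_def fst_conv snd_conv using partial_within_interior[OF y] by simp
qed

text \<open>At interior points the derivatives within the chart image become ordinary ones, and the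
  inverse metric and density combine into the coefficients of a divergence-form operator.\<close>

lemma laplacian_coords:
  assumes c: "(U, \<phi>) \<in> AM" and x: "x \<in> interior (\<phi> ` U)"
  defines "\<psi> \<equiv> inv_into U \<phi>"
  shows "laplacian g (U, \<phi>) u (\<psi> x) =
    (\<Sum>i\<in>UNIV. frechet_derivative (\<lambda>y. \<Sum>j\<in>UNIV.
        sqrt (det (g (U, \<phi>) (\<psi> y))) * matrix_inv (g (U, \<phi>) (\<psi> y)) $ i $ j *
        frechet_derivative (u \<circ> \<psi>) (at y) (axis j 1)) (at x) (axis i 1))
    / sqrt (det (g (U, \<phi>) (\<psi> x)))"
proof -
  have "\<phi> (\<psi> x) = x"
    using is_chartD(7)[OF chart_M[OF c]] x interior_subset unfolding \<psi>_def by blast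
  moreover have "partial_within (\<phi> ` U) i
      (\<lambda>y. sqrt (det (g (U, \<phi>) (\<psi> y))) * grad g (U, \<phi>) u (\<psi> y) $ i) x =
      frechet_derivative (\<lambda>y. \<Sum>j\<in>UNIV.
        sqrt (det (g (U, \<phi>) (\<psi> y))) * matrix_inv (g (U, \<phi>) (\<psi> y)) $ i $ j *
        frechet_derivative (u \<circ> \<psi>) (at y) (axis j 1)) (at x) (axis i 1)" for i
  proof -
    have "sqrt (det (g (U, \<phi>) (\<psi> y))) * grad g (U, \<phi>) u (\<psi> y) $ i =
      (\<Sum>j\<in>UNIV. sqrt (det (g (U, \<phi>) (\<psi> y))) * matrix_inv (g (U, \<phi>) (\<psi> y)) $ i $ j *
        frechet_derivative (u \<circ> \<psi>) (at y) (axis j 1))" if "y \<in> interior (\<phi> ` U)" for y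
      unfolding \<psi>_def grad_coords[OF c that]
      by (simp add: matrix_vector_mult_def sum_distrib_left mult.assoc)
    from frechet_derivative_cong[OF x this] show ?thesis
      unfolding partial_within_interior[OF x] at_within_open[OF x open_interior] by simp
  qed
  ultimately show ?thesis
    unfolding laplacian_def Let_def fst_conv snd_conv \<psi>_def by simp
qed

lemma metric_det:
  assumes "c \<in> AM" "x \<in> fst c"
  shows "det (g c x) \<noteq> 0"
proof -
  have "v = 0" if "g c x *v v = 0" for v
    using metric assms that unfolding riemannian_metric_def by (metis inner_zero_right less_irrefl)
  then show ?thesis
    by (metis invertible_det_nz invertible_left_inverse matrix_left_invertible_ker)
qed

text \<open>With \<open>w = g c x *v z\<close>, the value of the inverse form at \<open>w\<close> is
  that of the metric at \<open>z\<close>.\<close>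

lemma metric_inverse_pos:
  assumes c: "c \<in> AM" "x \<in> fst c" and "w \<noteq> 0"
  shows "0 < w \<bullet> (matrix_inv (g c x) *v w)"
proof -
  define z where "z = matrix_inv (g c x) *v w"
  have "g c x *v z = w"
    using matrix_inv_vector_eq[OF metric_det[OF c], of w z] unfolding z_def by simp
  moreover from this have "z \<noteq> 0" using \<open>w \<noteq> 0\<close> by auto
  then have "0 < z \<bullet> (g c x *v z)"
    using metric c unfolding riemannian_metric_def by blast
  ultimately show ?thesis unfolding z_def[symmetric] by (simp add: inner_commute)
qed

lemma metric_C1:
  assumes c: "(U, \<phi>) \<in> AM"
  shows "Ck_on (Suc 0) (interior (\<phi> ` U)) (\<lambda>y. g (U, \<phi>) (inv_into U \<phi> y) $ i $ j)"
proof -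
  have "smooth_on (\<phi> ` U) (g (U, \<phi>) \<circ> inv_into U \<phi>)"
    using metric c unfolding riemannian_metric_def by (metis fst_conv snd_conv)
  then have "Ck_on (Suc 0) (interior (\<phi> ` U)) (g (U, \<phi>) \<circ> inv_into U \<phi>)"
    unfolding smooth_on_def by (blast intro: Ck_on_open_subset[OF _ open_interior interior_subset])
  from Ck_on_1_vec_nth[OF open_interior Ck_on_1_vec_nth[OF open_interior this]]
  show ?thesis by simp
qed

text \<open>The compact set fed to the Lipschitz hypothesis is the union of the graphs of both
  functions over a compact piece of the chart. It stays in \<open>UNIV \<times> Y\<close>, which
  treats all reals and the positive reals alike.\<close>

lemma local_lipschitz:
  assumes c: "(U, \<phi>) \<in> AM" and K: "compact K" "K \<subseteq> \<phi> ` U"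
    and u: "continuous_on UNIV u\<^sub>1" "continuous_on UNIV u\<^sub>2" "\<And>x. u\<^sub>1 x \<in> Y" "\<And>x. u\<^sub>2 x \<in> Y"
    and f: "radial_loc_lipschitz G act Y f"
  obtains C where "C > 0" "\<And>y. y \<in> K \<Longrightarrow> \<bar>f (inv_into U \<phi> y) (u\<^sub>1 (inv_into U \<phi> y)) -
    f (inv_into U \<phi> y) (u\<^sub>2 (inv_into U \<phi> y))\<bar> \<le> C * \<bar>u\<^sub>1 (inv_into U \<phi> y) - u\<^sub>2 (inv_into U \<phi> y)\<bar>"
proof -
  define L where "L = inv_into U \<phi> ` K"
  have "compact L"
    using K continuous_on_subset[OF is_chartD(4)[OF chart_M[OF c]]] compact_continuous_image unfolding L_def by blast
  then have "compact ((\<lambda>x. (x, u\<^sub>1 x)) ` L \<union> (\<lambda>x. (x, u\<^sub>2 x)) ` L)"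
    using u(1,2)[THEN continuous_on_subset, OF subset_UNIV, of L]
    by (intro compact_Un compact_continuous_image continuous_intros) auto
  moreover have "(\<lambda>x. (x, u\<^sub>1 x)) ` L \<union> (\<lambda>x. (x, u\<^sub>2 x)) ` L \<subseteq> UNIV \<times> Y"
    using u(3,4) by auto
  ultimately obtain C where "C > 0" "\<forall>x y\<^sub>1 y\<^sub>2.
      (x, y\<^sub>1) \<in> (\<lambda>x. (x, u\<^sub>1 x)) ` L \<union> (\<lambda>x. (x, u\<^sub>2 x)) ` L \<and>
      (x, y\<^sub>2) \<in> (\<lambda>x. (x, u\<^sub>1 x)) ` L \<union> (\<lambda>x. (x, u\<^sub>2 x)) ` L \<longrightarrow>
      \<bar>f x y\<^sub>1 - f x y\<^sub>2\<bar> \<le> C * \<bar>y\<^sub>1 - y\<^sub>2\<bar>"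
    using f unfolding radial_loc_lipschitz_def by meson
  then show thesis by (intro that[of C]) (auto simp: L_def)
qed

text \<open>The first-order data may agree at any point \<open>x\<^sub>1\<close> of
  \<open>B\<close>, not only at the centre. This is what later lets coincidence reach a limit point
  of the section from nearby points.\<close>

lemma local_uniqueness:
  assumes s: "s \<in> regular_params AM G act \<iota>" and c: "(U, \<phi>) \<in> AM" "\<iota> s \<in> U"
    and sol: "interior_solution f u\<^sub>1" "interior_solution f u\<^sub>2"
    and Y: "\<And>x. u\<^sub>1 x \<in> Y" "\<And>x. u\<^sub>2 x \<in> Y" and f: "radial_loc_lipschitz G act Y f"
  obtains B where "open B" "\<iota> s \<in> B"
    "\<And>x\<^sub>1 x. x\<^sub>1 \<in> B \<Longrightarrow> u\<^sub>1 x\<^sub>1 = u\<^sub>2 x\<^sub>1 \<Longrightarrow> grad g (U, \<phi>) u\<^sub>1 x\<^sub>1 = grad g (U, \<phi>) u\<^sub>2 x\<^sub>1 \<Longrightarrow>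
      x \<in> B \<Longrightarrow> u\<^sub>1 x = u\<^sub>2 x"
proof -
  define D where "D = interior (\<phi> ` U)"
  define \<psi> where "\<psi> = inv_into U \<phi>"
  define x0 where "x0 = \<phi> (\<iota> s)"
  note ch = is_chartD[OF chart_M[OF c(1)], folded \<psi>_def]
  have D: "open D" "D \<subseteq> \<phi> ` U" unfolding D_def by (auto simp: interior_subset)
  have x0: "x0 \<in> D"
    using regular_interior[OF c] s unfolding x0_def D_def regular_params_def by auto
  note C2D = sol[THEN interior_solutionD(3), OF c(1), folded D_def \<psi>_def]
  define p\<^sub>1 where "p\<^sub>1 = (\<lambda>j y. frechet_derivative (u\<^sub>1 \<circ> \<psi>) (at y) (axis j 1))"
  define p\<^sub>2 where "p\<^sub>2 = (\<lambda>j y. frechet_derivative (u\<^sub>2 \<circ> \<psi>) (at y) (axis j 1))"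
  define p where "p = (\<lambda>j y. p\<^sub>1 j y - p\<^sub>2 j y)"
  define v where "v = (\<lambda>y. (u\<^sub>1 \<circ> \<psi>) y - (u\<^sub>2 \<circ> \<psi>) y)"
  have p\<^sub>1\<^sub>2: "Ck_on (Suc 0) D (p\<^sub>1 j)" "Ck_on (Suc 0) D (p\<^sub>2 j)" for j
    unfolding p\<^sub>1_def p\<^sub>2_def using C2D[THEN Ck_on_2_open(2)[OF D(1)]] by auto
  have p: "Ck_on (Suc 0) D (p j)" for j
    unfolding p_def by (intro Ck_on_1_diff D p\<^sub>1\<^sub>2)
  have du: "((u\<^sub>1 \<circ> \<psi>) has_derivative frechet_derivative (u\<^sub>1 \<circ> \<psi>) (at y)) (at y)"
    "((u\<^sub>2 \<circ> \<psi>) has_derivative frechet_derivative (u\<^sub>2 \<circ> \<psi>) (at y)) (at y)" if "y \<in> D" for y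
    using C2D[THEN Ck_on_2_open(1)[OF D(1)]] that by auto
  have sum_p: "(\<Sum>j\<in>UNIV. h $ j * p j y) =
      frechet_derivative (u\<^sub>1 \<circ> \<psi>) (at y) h - frechet_derivative (u\<^sub>2 \<circ> \<psi>) (at y) h" if "y \<in> D" for h y
    using linear_axis_expansion[OF has_derivative_linear[OF du(1)[OF that]], of h]
      linear_axis_expansion[OF has_derivative_linear[OF du(2)[OF that]], of h]
    unfolding p_def p\<^sub>1_def p\<^sub>2_def by (simp add: right_diff_distrib sum_subtractf)
  have dv: "(v has_derivative (\<lambda>h. \<Sum>j\<in>UNIV. h $ j * p j y)) (at y)" if "y \<in> D" for y
    unfolding v_def sum_p[OF that] using du[OF that] by (rule has_derivative_diff)

  obtain e a :: "real^'n" and Z where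
    "(\<forall>j. Ck_on (Suc 0) D (Z j)) \<and> (\<forall>j. axis j 1 = a $ j *\<^sub>R e + Z j x0) \<and> a \<bullet> e = 1 \<and>
    (\<forall>u x j. radial G act u \<longrightarrow> x \<in> D \<longrightarrow> (u \<circ> \<psi>) differentiable (at x) \<longrightarrow>
      frechet_derivative (u \<circ> \<psi>) (at x) (Z j x) = 0)"
    using orbit_fields[OF s c, folded D_def \<psi>_def x0_def] by (elim exE)
  then have Z: "\<And>j. Ck_on (Suc 0) D (Z j)" "\<And>j. axis j 1 = a $ j *\<^sub>R e + Z j x0" "a \<bullet> e = 1"
    "\<And>u x j. radial G act u \<Longrightarrow> x \<in> D \<Longrightarrow> (u \<circ> \<psi>) differentiable (at x) \<Longrightarrow>
          frechet_derivative (u \<circ> \<psi>) (at x) (Z j x) = 0"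
    by blast+
  have Zp: "(\<Sum>i\<in>UNIV. Z j y $ i * p i y) = 0" if "y \<in> D" for j y
  proof -
    have "frechet_derivative (u\<^sub>1 \<circ> \<psi>) (at y) (Z j y) = 0"
      using Z(4)[OF interior_solutionD(2)[OF sol(1)] that] du(1)[OF that] by (blast intro: differentiableI)
    moreover have "frechet_derivative (u\<^sub>2 \<circ> \<psi>) (at y) (Z j y) = 0"
      using Z(4)[OF interior_solutionD(2)[OF sol(2)] that] du(2)[OF that] by (blast intro: differentiableI)
    ultimately show ?thesis unfolding sum_p[OF that] by simp
  qed
  \<comment> \<open>Row \<open>j\<close> is the splitting of the axis \<open>j\<close> at
    \<open>x0\<close>, with the orbit part moved along as a field and \<open>e\<close> kept
    constant; hence \<open>M x0\<close> is the identity. Applied to the gradient of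
    \<open>v\<close>, the orbit parts vanish and \<open>M\<close> gives \<open>l\<close> times
    \<open>a\<close>, so the gradient is \<open>l\<close> times the solution \<open>N\<close> of
    \<open>M N = a\<close>.\<close>
  define M where "M = (\<lambda>y. \<chi> j i. a $ j * e $ i + Z j y $ i)"
  define N where "N = (\<lambda>j y. \<Sum>k\<in>UNIV. matrix_inv (M y) $ j $ k * a $ k)"
  have N_vec: "N j y = (matrix_inv (M y) *v a) $ j" for j y
    unfolding N_def matrix_vector_mult_def by simp
  have "M x0 = mat 1"
  proof -
    have "M x0 $ j $ i = axis j 1 $ i" for i j
      using Z(2)[of j] unfolding M_def by simp
    then show ?thesis by (auto simp: vec_eq_iff mat_def axis_def)
  qed
  then have det0: "det (M x0) \<noteq> 0" by (simp add: det_I)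
  have N0: "N j x0 = a $ j" for j
    using matrix_inv_vector_eq[OF det0, of a a] \<open>M x0 = mat 1\<close> unfolding N_vec by simp
  have M_C1: "Ck_on (Suc 0) D (\<lambda>y. M y $ j $ i)" for i j
    unfolding M_def using D(1) Ck_on_1_vec_nth[OF D(1) Z(1)]
    by (simp add: Ck_on_1_add Ck_on_1_const del: Ck_on.simps)
  have M_p: "M y *v (\<chi> i. p i y) = (\<Sum>i\<in>UNIV. e $ i * p i y) *s a" if "y \<in> D" for y
  proof (rule vec_eq_iff[THEN iffD2, rule_format])
    fix j
    have "(M y *v (\<chi> i. p i y)) $ j = (\<Sum>i\<in>UNIV. a $ j * (e $ i * p i y) + Z j y $ i * p i y)"
      unfolding matrix_vector_mult_def M_def by (simp only: vec_lambda_beta distrib_right mult.assoc)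
    also have "\<dots> = a $ j * (\<Sum>i\<in>UNIV. e $ i * p i y) + (\<Sum>i\<in>UNIV. Z j y $ i * p i y)"
      by (simp only: sum.distrib sum_distrib_left)
    finally show "(M y *v (\<chi> i. p i y)) $ j = ((\<Sum>i\<in>UNIV. e $ i * p i y) *s a) $ j"
      unfolding Zp[OF that] by (simp add: mult.commute)
  qed
  have pN: "p i y = (\<Sum>j\<in>UNIV. e $ j * p j y) * N i y" if "y \<in> D" "det (M y) \<noteq> 0" for i y
  proof -
    have "matrix_inv (M y) *v ((\<Sum>i\<in>UNIV. e $ i * p i y) *s a) = (\<chi> i. p i y)"
      using matrix_inv_vector_eq[OF that(2)] M_p[OF that(1)] by simp
    then have "(\<Sum>i\<in>UNIV. e $ i * p i y) *s (matrix_inv (M y) *v a) = (\<chi> i. p i y)"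
      by (simp only: vector_scalar_commute)
    then show ?thesis
      unfolding N_vec by (metis vec_lambda_beta vector_smult_component)
  qed

  define \<rho> where "\<rho> = (\<lambda>y. sqrt (det (g (U, \<phi>) (\<psi> y))))"
  define A where "A = (\<lambda>i j y. \<rho> y * matrix_inv (g (U, \<phi>) (\<psi> y)) $ i $ j)"
  have \<psi>U: "\<psi> y \<in> fst (U, \<phi>)" if "y \<in> D" for y
    using that D(2) ch(8) by auto
  have det_g: "det (g (U, \<phi>) (\<psi> y)) \<noteq> 0" if "y \<in> D" for y
    by (rule metric_det[OF c(1) \<psi>U[OF that]])
  note g_C1 = metric_C1[OF c(1), folded D_def \<psi>_def]
  have \<rho>_C1: "Ck_on (Suc 0) D \<rho>"
    unfolding \<rho>_def by (intro Ck_on_1_sqrt Ck_on_1_det g_C1 D(1) det_g)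
  have A_C1: "Ck_on (Suc 0) D (A i j)" for i j
    unfolding A_def by (intro Ck_on_1_mult Ck_on_1_matrix_inv \<rho>_C1 g_C1 D(1) det_g)
  have \<rho>_nz: "\<rho> y \<noteq> 0" if "y \<in> D" for y
    unfolding \<rho>_def using det_g[OF that] by simp
  have div: "(\<Sum>i\<in>UNIV. frechet_derivative (\<lambda>y. \<Sum>j\<in>UNIV. A i j y * p j y) (at y) (axis i 1)) =
      \<rho> y * (f (\<psi> y) (u\<^sub>1 (\<psi> y)) - f (\<psi> y) (u\<^sub>2 (\<psi> y)))" if y: "y \<in> D" for y
  proof -
    \<comment> \<open>\<open>frechet_derivative\<close> is known to be additive only on
      differentiable functions, so each solution's divergence is treated separately.\<close>
    have split: "frechet_derivative (\<lambda>y. \<Sum>j\<in>UNIV. A i j y * p j y) (at y) h =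
      frechet_derivative (\<lambda>y. \<Sum>j\<in>UNIV. A i j y * p\<^sub>1 j y) (at y) h -
      frechet_derivative (\<lambda>y. \<Sum>j\<in>UNIV. A i j y * p\<^sub>2 j y) (at y) h" for i h
    proof -
      have diff: "((\<lambda>y. \<Sum>j\<in>UNIV. A i j y * q j y) has_derivative
          frechet_derivative (\<lambda>y. \<Sum>j\<in>UNIV. A i j y * q j y) (at y)) (at y)"
        if "\<And>j. Ck_on (Suc 0) D (q j)" for q
      proof -
        have "Ck_on (Suc 0) D (\<lambda>y. \<Sum>j\<in>UNIV. A i j y * q j y)"
          by (intro Ck_on_1_sum Ck_on_1_mult A_C1 that D(1))
        then show ?thesis by (rule Ck_on_1_has_derivative[OF D(1) _ y])
      qed
      have eq: "(\<lambda>y. \<Sum>j\<in>UNIV. A i j y * p j y) =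
          (\<lambda>y. (\<Sum>j\<in>UNIV. A i j y * p\<^sub>1 j y) - (\<Sum>j\<in>UNIV. A i j y * p\<^sub>2 j y))"
        unfolding p_def by (simp add: right_diff_distrib sum_subtractf)
      show ?thesis
        unfolding eq
        by (rule fun_cong[OF frechet_derivative_at[OF has_derivative_diff[OF
            diff[of p\<^sub>1, OF p\<^sub>1\<^sub>2(1)] diff[of p\<^sub>2, OF p\<^sub>1\<^sub>2(2)]], symmetric]])
    qed
    have lap: "(\<Sum>i\<in>UNIV. frechet_derivative (\<lambda>y. \<Sum>j\<in>UNIV. A i j y *
        frechet_derivative (u \<circ> \<psi>) (at y) (axis j 1)) (at y) (axis i 1)) = \<rho> y * f (\<psi> y) (u (\<psi> y))"
      if "interior_solution f u" for u
    proof -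
      have "laplacian g (U, \<phi>) u (\<psi> y) = f (\<psi> y) (u (\<psi> y))"
        using interior_solutionD(4)[OF that c(1), of "\<psi> y"] \<psi>U[OF y] ch(7)[of y] y D(2)
        unfolding D_def by auto
      moreover have "laplacian g (U, \<phi>) u (\<psi> y) = (\<Sum>i\<in>UNIV. frechet_derivative (\<lambda>y. \<Sum>j\<in>UNIV. A i j y *
        frechet_derivative (u \<circ> \<psi>) (at y) (axis j 1)) (at y) (axis i 1)) / \<rho> y"
        unfolding A_def \<rho>_def \<psi>_def using laplacian_coords[OF c(1), of y u] y unfolding D_def by simp
      ultimately show ?thesis using \<rho>_nz[OF y] by (simp add: field_simps)
    qed
    show ?thesis
      using lap[OF sol(1)] lap[OF sol(2)] unfolding split sum_subtractf p\<^sub>1_def p\<^sub>2_def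
      by (simp add: right_diff_distrib)
  qed

  define D' where "D' = {y \<in> D. det (M y) \<noteq> 0}"
  have "D' = D \<inter> (\<lambda>y. det (M y)) -` (- {0})" unfolding D'_def by auto
  then have "open D'"
    using continuous_open_preimage[OF Ck_on_1_imp_continuous_on[OF Ck_on_1_det[OF D(1) M_C1]] D(1)]
    by (metis closed_singleton open_Compl)
  moreover have "x0 \<in> D'" using x0 det0 unfolding D'_def by simp
  ultimately obtain r where r: "r > 0" "cball x0 r \<subseteq> D'"
    using open_contains_cball by blast
  have rD: "cball x0 r \<subseteq> D" using r(2) unfolding D'_def by blast
  \<comment> \<open>The estimates need compactness and hold on the closed ball; the continuation
    lemma needs an open domain.\<close>
  define W where "W = ball x0 r"
  have W: "open W" "x0 \<in> W" "W \<subseteq> D" "W \<subseteq> D'" "W \<subseteq> cball x0 r"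
    using r rD ball_subset_cball[of x0 r] unfolding W_def by auto
  obtain C where C: "C > 0" "\<And>y. y \<in> cball x0 r \<Longrightarrow>
      \<bar>f (\<psi> y) (u\<^sub>1 (\<psi> y)) - f (\<psi> y) (u\<^sub>2 (\<psi> y))\<bar> \<le> C * \<bar>u\<^sub>1 (\<psi> y) - u\<^sub>2 (\<psi> y)\<bar>"
    using local_lipschitz[OF c(1) compact_cball _ sol[THEN interior_solutionD(1)] Y f, of x0 r] rD D(2)
    unfolding \<psi>_def by blast
  have "bounded (\<rho> ` cball x0 r)"
    using continuous_on_subset[OF Ck_on_1_imp_continuous_on[OF \<rho>_C1] rD]
    by (intro compact_imp_bounded compact_continuous_image) auto
  then obtain R where R: "\<And>y. y \<in> cball x0 r \<Longrightarrow> \<bar>\<rho> y\<bar> \<le> R"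
    unfolding bounded_iff real_norm_def by blast
  have "R \<ge> 0" using R[of x0] r(1) by simp
  have bound: "\<bar>\<Sum>i\<in>UNIV. frechet_derivative (\<lambda>y. \<Sum>j\<in>UNIV. A i j y * p j y) (at y) (axis i 1)\<bar>
      \<le> (R * C) * \<bar>v y\<bar>" if "y \<in> W" for y
  proof -
    have y: "y \<in> D" "y \<in> cball x0 r" using that W by auto
    have "\<bar>\<rho> y\<bar> * \<bar>f (\<psi> y) (u\<^sub>1 (\<psi> y)) - f (\<psi> y) (u\<^sub>2 (\<psi> y))\<bar> \<le> R * (C * \<bar>u\<^sub>1 (\<psi> y) - u\<^sub>2 (\<psi> y)\<bar>)"
      using R[OF y(2)] C(2)[OF y(2)] \<open>R \<ge> 0\<close> by (intro mult_mono) auto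
    then show ?thesis
      unfolding div[OF y(1)] abs_mult v_def by (simp add: mult.assoc)
  qed
  have N_C1: "Ck_on (Suc 0) W (N j)" for j
    unfolding N_def
    by (intro Ck_on_1_sum Ck_on_1_mult Ck_on_1_matrix_inv Ck_on_1_const
        Ck_on_1_subset[OF D(1) W(1,3) M_C1] W(1)) (use W(4) in \<open>auto simp: D'_def\<close>)
  \<comment> \<open>At \<open>x0\<close> the field \<open>N\<close> equals \<open>a\<close>, so this
    number is \<open>a \<bullet> e = 1\<close>. The next one is the density times the inverse metric
    at \<open>a\<close>, nonzero because \<open>a\<close> is.\<close>
  have nz: "(\<Sum>i\<in>UNIV. e $ i * N i x0) \<noteq> 0"
    using Z(3) unfolding N0 inner_vec_def by (simp add: mult.commute)
  have nzQ: "(\<Sum>i\<in>UNIV. \<Sum>j\<in>UNIV. A i j x0 * N i x0 * N j x0) \<noteq> 0"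
  proof -
    have "(\<Sum>i\<in>UNIV. \<Sum>j\<in>UNIV. A i j x0 * N i x0 * N j x0) =
        \<rho> x0 * (a \<bullet> (matrix_inv (g (U, \<phi>) (\<psi> x0)) *v a))"
      unfolding N0 A_def inner_vec_def matrix_vector_mult_def
      by (simp add: sum_distrib_left mult_ac)
    moreover have "a \<noteq> 0" using Z(3) by auto
    ultimately show ?thesis
      using metric_inverse_pos[OF c(1) \<psi>U[OF x0], of a] \<rho>_nz[OF x0] by simp
  qed
  have "\<exists>r>0. ball x0 r \<subseteq> W \<and>
    (\<forall>x1\<in>ball x0 r. v x1 = 0 \<and> (\<forall>j. p j x1 = 0) \<longrightarrow> (\<forall>x\<in>ball x0 r. v x = 0))"
  proof (rule local_unique_continuation[OF W(1,2) _ _ N_C1 _ _ nz nzQ _ bound])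
    show "(v has_derivative (\<lambda>h. \<Sum>j\<in>UNIV. h $ j * p j x)) (at x)" if "x \<in> W" for x
      using dv that W(3) by blast
    show "p i x = (\<Sum>j\<in>UNIV. e $ j * p j x) * N i x" if "x \<in> W" for i x
      using pN[of x i] subsetD[OF W(4) that] unfolding D'_def by blast
    show "Ck_on (Suc 0) W (p j)" "Ck_on (Suc 0) W (A i j)" for i j
      by (rule Ck_on_1_subset[OF D(1) W(1,3)], rule p A_C1)+
    show "0 \<le> R * C" using \<open>R \<ge> 0\<close> C(1) by simp
  qed
  then obtain r' where r': "r' > 0" "ball x0 r' \<subseteq> W"
    "\<forall>x1\<in>ball x0 r'. v x1 = 0 \<and> (\<forall>j. p j x1 = 0) \<longrightarrow> (\<forall>x\<in>ball x0 r'. v x = 0)"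
    by blast
  show thesis
  proof (rule that)
    show "open (U \<inter> \<phi> -` ball x0 r')"
      by (rule continuous_open_preimage[OF ch(3,1)]) simp
    show "\<iota> s \<in> U \<inter> \<phi> -` ball x0 r'"
      using c(2) r'(1) unfolding x0_def by simp
  next
    fix x\<^sub>1 x assume x: "x\<^sub>1 \<in> U \<inter> \<phi> -` ball x0 r'" "x \<in> U \<inter> \<phi> -` ball x0 r'"
      and eq: "u\<^sub>1 x\<^sub>1 = u\<^sub>2 x\<^sub>1" "grad g (U, \<phi>) u\<^sub>1 x\<^sub>1 = grad g (U, \<phi>) u\<^sub>2 x\<^sub>1"
    have inv: "\<psi> (\<phi> x) = x" "\<psi> (\<phi> x\<^sub>1) = x\<^sub>1" using x ch(6) by auto
    have "\<phi> x\<^sub>1 \<in> D" using x(1) r'(2) W(3) by auto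
    then have "\<phi> x\<^sub>1 \<in> interior (\<phi> ` U)" unfolding D_def .
    \<comment> \<open>Equality of the gradients is equality of the partial derivatives after
      applying the inverse metric; invertibility gives back the partial derivatives
      themselves.\<close>
    from eq(2) have "matrix_inv (g (U, \<phi>) x\<^sub>1) *v (\<chi> j. p\<^sub>1 j (\<phi> x\<^sub>1)) = matrix_inv (g (U, \<phi>) x\<^sub>1) *v (\<chi> j. p\<^sub>2 j (\<phi> x\<^sub>1))"
      using grad_coords[OF c(1) \<open>\<phi> x\<^sub>1 \<in> interior (\<phi> ` U)\<close>] inv
      unfolding p\<^sub>1_def p\<^sub>2_def \<psi>_def by simp
    moreover have "det (g (U, \<phi>) x\<^sub>1) \<noteq> 0"
      using metric_det[OF c(1)] x(1) by simp
    ultimately have "(\<chi> j. p\<^sub>1 j (\<phi> x\<^sub>1)) = (\<chi> j. p\<^sub>2 j (\<phi> x\<^sub>1))"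
      by (metis matrix_inv_mult(2) matrix_vector_mul_assoc matrix_vector_mul_lid)
    then have "p j (\<phi> x\<^sub>1) = 0" for j
      unfolding p_def by (simp add: vec_eq_iff)
    moreover have "v (\<phi> x\<^sub>1) = 0" using eq(1) inv unfolding v_def by simp
    ultimately have "v (\<phi> x) = 0" using r'(3) x unfolding Int_iff vimage_eq by blast
    then show "u\<^sub>1 x = u\<^sub>2 x" using inv unfolding v_def by simp
  qed
qed

section \<open>From neighbourhoods to the whole manifold\<close>

lemma grad_cong:
  assumes c: "(U, \<phi>) \<in> AM" and x: "x \<in> U" "x \<in> regular_points AM G act"
    and W: "open W" "x \<in> W" "\<And>y. y \<in> W \<Longrightarrow> u\<^sub>1 y = u\<^sub>2 y"
  shows "grad g (U, \<phi>) u\<^sub>1 x = grad g (U, \<phi>) u\<^sub>2 x"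
proof -
  note ch = is_chartD[OF chart_M[OF c]]
  have int: "\<phi> x \<in> interior (\<phi> ` U)" by (rule regular_interior[OF c x])
  define S where "S = interior (\<phi> ` U) \<inter> inv_into U \<phi> -` W"
  have "open S"
    unfolding S_def
    by (rule continuous_open_preimage[OF continuous_on_subset[OF ch(4) interior_subset] open_interior W(1)])
  have "\<phi> x \<in> S" using int ch(6)[OF x(1)] W(2) unfolding S_def by simp
  have "frechet_derivative (u\<^sub>1 \<circ> inv_into U \<phi>) (at (\<phi> x) within S) =
      frechet_derivative (u\<^sub>2 \<circ> inv_into U \<phi>) (at (\<phi> x) within S)"
    by (rule frechet_derivative_cong[OF \<open>\<phi> x \<in> S\<close>]) (simp add: S_def W(3))
  then show ?thesis
    using grad_coords[OF c int, of u\<^sub>1] grad_coords[OF c int, of u\<^sub>2] ch(6)[OF x(1)]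
    unfolding at_within_open[OF \<open>\<phi> x \<in> S\<close> \<open>open S\<close>] by simp
qed

lemma continuous_\<iota>: "continuous_on UNIV \<iota>"
proof -
  have "isCont \<iota> s" for s
  proof -
    obtain N \<theta> where d: "(N, \<theta>) \<in> AN" "s \<in> N"
      by (rule smooth_manifold_chartE[OF manifold_N])
    have "is_chart half_space (N, \<theta>)"
      using manifold_N d(1) unfolding smooth_manifold_def by blast
    moreover have "continuous_on N \<iota>"
      using immersed(1) d(1) unfolding immersion_def smooth_map_def by blast
    ultimately show ?thesis
      using d(2) is_chartD(1) continuous_on_eq_continuous_at by metis
  qed
  then show ?thesis by (simp add: continuous_at_imp_continuous_on)
qed

text \<open>The set \<open>Z\<close> asks for coincidence on a neighbourhood in the manifold, not
  merely along the section. It is therefore open, and at its regular parameters the full gradients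
  agree, which is the input of \<open>local_uniqueness\<close>. Connectedness is used in the
  parameter space, into which neighbourhoods are pulled back by \<open>\<iota>\<close>.\<close>

lemma radial_solutions_unique:
  assumes dense: "closure (regular_points AM G act) = UNIV"
    and sol: "interior_solution f u\<^sub>1" "interior_solution f u\<^sub>2"
    and Y: "\<And>x. u\<^sub>1 x \<in> Y" "\<And>x. u\<^sub>2 x \<in> Y" and f: "radial_loc_lipschitz G act Y f"
    and p: "p \<in> \<iota> ` regular_params AM G act \<iota>" "u\<^sub>1 p = u\<^sub>2 p"
      "\<And>c. c \<in> AM \<Longrightarrow> p \<in> fst c \<Longrightarrow> grad g c u\<^sub>1 p = grad g c u\<^sub>2 p"
  shows "u\<^sub>1 x = u\<^sub>2 x"
proof -
  define S where "S = regular_params AM G act \<iota>"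
  define Z where "Z = {s. \<exists>W. open W \<and> \<iota> s \<in> W \<and> (\<forall>y\<in>W. u\<^sub>1 y = u\<^sub>2 y)}"
  \<comment> \<open>One neighbourhood with two uses: coincidence near a point of the section inside
    it spreads over all of it, and equal first-order data at \<open>\<iota> s\<close> start the
    process.\<close>
  have local: "\<exists>B. open B \<and> \<iota> s \<in> B \<and> (\<forall>t\<in>S. \<iota> t \<in> B \<and> t \<in> Z \<longrightarrow> (\<forall>y\<in>B. u\<^sub>1 y = u\<^sub>2 y)) \<and>
      (u\<^sub>1 (\<iota> s) = u\<^sub>2 (\<iota> s) \<and> (\<forall>c\<in>AM. \<iota> s \<in> fst c \<longrightarrow> grad g c u\<^sub>1 (\<iota> s) = grad g c u\<^sub>2 (\<iota> s)) \<longrightarrow>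
        (\<forall>y\<in>B. u\<^sub>1 y = u\<^sub>2 y))" if s: "s \<in> S" for s
  proof -
    obtain U \<phi> where c: "(U, \<phi>) \<in> AM" "\<iota> s \<in> U"
      by (rule smooth_manifold_chartE[OF manifold_M])
    obtain B where B: "open B" "\<iota> s \<in> B"
      "\<And>x\<^sub>1 x. x\<^sub>1 \<in> B \<Longrightarrow> u\<^sub>1 x\<^sub>1 = u\<^sub>2 x\<^sub>1 \<Longrightarrow> grad g (U, \<phi>) u\<^sub>1 x\<^sub>1 = grad g (U, \<phi>) u\<^sub>2 x\<^sub>1 \<Longrightarrow>
        x \<in> B \<Longrightarrow> u\<^sub>1 x = u\<^sub>2 x"
      using local_uniqueness[OF s[unfolded S_def] c sol Y f] by blast
    have "open (B \<inter> U)" using B(1) is_chartD(1)[OF chart_M[OF c(1)]] by blast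
    moreover have "u\<^sub>1 y = u\<^sub>2 y" if t: "t \<in> S" "\<iota> t \<in> B \<inter> U" "t \<in> Z" and y: "y \<in> B \<inter> U" for t y
    proof -
      obtain W where W: "open W" "\<iota> t \<in> W" "\<And>y. y \<in> W \<Longrightarrow> u\<^sub>1 y = u\<^sub>2 y"
        using t(3) unfolding Z_def by blast
      have "grad g (U, \<phi>) u\<^sub>1 (\<iota> t) = grad g (U, \<phi>) u\<^sub>2 (\<iota> t)"
        by (rule grad_cong[OF c(1) _ _ W]) (use t in \<open>auto simp: S_def regular_params_def\<close>)
      then show ?thesis using B(3)[of "\<iota> t" y] W(2,3) t(2) y by blast
    qed
    moreover have "u\<^sub>1 y = u\<^sub>2 y" if "u\<^sub>1 (\<iota> s) = u\<^sub>2 (\<iota> s)" "y \<in> B \<inter> U"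
      "\<forall>c\<in>AM. \<iota> s \<in> fst c \<longrightarrow> grad g c u\<^sub>1 (\<iota> s) = grad g c u\<^sub>2 (\<iota> s)" for y
      using B(3)[OF B(2) that(1), of y] that c by auto
    ultimately show ?thesis using B(2) c(2) by (intro exI[of _ "B \<inter> U"]) blast
  qed
  have preim: "open (\<iota> -` B)" if "open B" for B
    using open_vimage[OF that continuous_\<iota>] .
  have "open Z"
  proof (subst open_subopen, intro ballI)
    fix s assume "s \<in> Z"
    then obtain W where "open W" "\<iota> s \<in> W" "\<forall>y\<in>W. u\<^sub>1 y = u\<^sub>2 y" unfolding Z_def by blast
    then show "\<exists>T. open T \<and> s \<in> T \<and> T \<subseteq> Z"
      using preim[of W] unfolding Z_def by (intro exI[of _ "\<iota> -` W"]) blast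
  qed
  \<comment> \<open>If the preimage of \<open>B\<close> contained a parameter in
    \<open>S \<inter> Z\<close>, coincidence would hold on \<open>B\<close> and put \<open>s\<close>
    itself into \<open>Z\<close>.\<close>
  moreover have "\<exists>T. open T \<and> s \<in> T \<and> (T \<inter> S \<inter> Z = {})" if sZ: "s \<in> S - Z" for s
  proof -
    obtain B where B: "open B" "\<iota> s \<in> B" "\<forall>t\<in>S. \<iota> t \<in> B \<and> t \<in> Z \<longrightarrow> (\<forall>y\<in>B. u\<^sub>1 y = u\<^sub>2 y)"
      using local[of s] sZ by auto
    then show ?thesis
      using preim[OF B(1)] sZ unfolding Z_def by (intro exI[of _ "\<iota> -` B"]) blast
  qed
  then obtain T where T: "\<And>s. s \<in> S - Z \<Longrightarrow> open (T s) \<and> s \<in> T s \<and> T s \<inter> S \<inter> Z = {}"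
    by metis
  \<comment> \<open>\<open>connectedD\<close> takes open sets of the whole parameter space, so the
    rest of \<open>S\<close> is thickened to an open set missing
    \<open>S \<inter> Z\<close>.\<close>
  define Z' where "Z' = (\<Union>s\<in>S - Z. T s)"
  have "open Z'" unfolding Z'_def using T by blast
  have "S \<subseteq> Z \<union> Z'" "Z \<inter> Z' \<inter> S = {}" unfolding Z'_def using T by blast+
  moreover obtain s where "s \<in> S" "p = \<iota> s" using p(1) unfolding S_def by blast
  then have "s \<in> Z \<inter> S"
    using local[OF \<open>s \<in> S\<close>] p(2,3) unfolding Z_def by blast
  ultimately have "Z' \<inter> S = {}"
    using connectedD[of S Z Z'] connected_params \<open>open Z\<close> \<open>open Z'\<close> unfolding S_def by blast
  then have SZ: "S \<subseteq> Z" using \<open>S \<subseteq> Z \<union> Z'\<close> by blast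
  have eq: "u\<^sub>1 y = u\<^sub>2 y" if "y \<in> regular_points AM G act" for y
  proof -
    obtain t where t: "t \<in> S" "y \<in> orbit G act (\<iota> t)"
      using regular_eq \<open>y \<in> _\<close> unfolding S_def by blast
    then obtain a where "a \<in> carrier G" "y = act a (\<iota> t)" unfolding orbit_def by blast
    moreover have "u\<^sub>1 (\<iota> t) = u\<^sub>2 (\<iota> t)" using SZ t(1) unfolding Z_def by blast
    ultimately show ?thesis using sol[THEN interior_solutionD(2)] unfolding radial_def by simp
  qed
  have "closed {y. u\<^sub>1 y = u\<^sub>2 y}"
    by (intro closed_Collect_eq sol[THEN interior_solutionD(1)])
  then have "closure (regular_points AM G act) \<subseteq> {y. u\<^sub>1 y = u\<^sub>2 y}"
    using eq by (intro closure_minimal) auto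
  then show ?thesis unfolding dense by blast
qed

lemma grad_zero:
  assumes "c \<in> AM" "x \<in> fst c" "x \<in> regular_points AM G act"
  shows "grad g c (\<lambda>x. 0) x = 0"
proof -
  obtain U \<phi> where c: "c = (U, \<phi>)" by (cases c)
  note ch = is_chartD[OF chart_M[OF assms(1)[unfolded c]]]
  have "\<phi> x \<in> interior (\<phi> ` U)"
    using regular_interior assms unfolding c by simp
  moreover have "(\<lambda>x. 0) \<circ> inv_into U \<phi> = (\<lambda>y. 0)" by auto
  ultimately show ?thesis
    using grad_coords[OF assms(1)[unfolded c], of "\<phi> x" "\<lambda>x. 0"] ch(6)[of x] assms(2)
    unfolding c by (simp add: zero_vec_def[symmetric])
qed

lemma zero_interior_solution:
  assumes "\<And>x. f x 0 = 0"
  shows "interior_solution f (\<lambda>x. 0)"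
proof -
  have zero: "(\<lambda>x. 0 :: real) \<circ> inv_into U \<phi> = (\<lambda>y. 0)" for U and \<phi> :: "'m \<Rightarrow> real^'n" by auto
  have "Ck_on (Suc (Suc 0)) (interior (\<phi> ` U)) ((\<lambda>x. 0 :: real) \<circ> inv_into U \<phi>)"
    for U and \<phi> :: "'m \<Rightarrow> real^'n"
  proof -
    have *: "Ck_on (Suc 0) (interior (\<phi> ` U))
        (\<lambda>x. frechet_derivative (\<lambda>y. 0 :: real) (at x within interior (\<phi> ` U)) v)" for v
      by (rule Ck_on_1_cong[OF open_interior Ck_on_1_const[OF open_interior, of _ 0]])
        (simp add: at_within_open[OF _ open_interior])
    then show ?thesis
      unfolding zero Ck_on.simps(2)[of "Suc 0"] by (intro conjI ballI allI differentiable_const *)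
  qed
  moreover have "laplacian g (U, \<phi>) (\<lambda>x. 0) x = 0"
    if "(U, \<phi>) \<in> AM" "x \<in> U" "\<phi> x \<in> interior (\<phi> ` U)" for U \<phi> x
    using laplacian_coords[OF that(1,3), of "\<lambda>x. 0"] is_chartD(6)[OF chart_M[OF that(1)] that(2)]
    unfolding zero by simp
  ultimately show ?thesis
    using assms unfolding interior_solution_def radial_def numeral_2_eq_2 by auto
qed

end

theorem corollary2p7:
  fixes AM :: "('m::t2_space, real^'n) atlas"
    and g :: "('m, 'n) metric_tensor"
    and G :: "'g::{t2_space, second_countable_topology} monoid"
    and AG :: "('g, 'h::real_normed_vector) atlas"
    and act :: "'g \<Rightarrow> 'm \<Rightarrow> 'm"
    and AN :: "('l::t2_space, real) atlas"
    and \<iota> :: "'l \<Rightarrow> 'm"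
    and f :: "'m \<Rightarrow> real \<Rightarrow> real"
    and u\<^sub>1 u\<^sub>2 :: "'m \<Rightarrow> real"
  defines "\<Sigma> \<equiv> \<iota> ` regular_params AM G act \<iota>"
  assumes "polar_setting AM g G AG act AN \<iota>"
    and "unimodular G"
    and "closure (regular_points AM G act) = UNIV"
    and "Ck_fun AM 2 UNIV u\<^sub>1" and "Ck_fun AM 2 UNIV u\<^sub>2"
    and "radial G act u\<^sub>1" and "radial G act u\<^sub>2"
    and "solution AM g f u\<^sub>1" and "solution AM g f u\<^sub>2"
  shows
    "((\<exists>p\<in>\<Sigma>. u\<^sub>1 p = u\<^sub>2 p \<and> (\<forall>c\<in>AM. p \<in> fst c \<longrightarrow> grad g c u\<^sub>1 p = grad g c u\<^sub>2 p)) \<and>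
      (radial_loc_lipschitz G act UNIV f \<or>
       (\<forall>x. 0 < u\<^sub>1 x \<and> 0 < u\<^sub>2 x) \<and> radial_loc_lipschitz G act {0<..} f)
      \<longrightarrow> (\<forall>x. u\<^sub>1 x = u\<^sub>2 x)) \<and>
     (radial_loc_lipschitz G act UNIV f \<and> (\<forall>x. f x 0 = 0) \<and>
      (\<exists>p\<in>\<Sigma>. u\<^sub>1 p = 0 \<and> (\<forall>c\<in>AM. p \<in> fst c \<longrightarrow> grad g c u\<^sub>1 p = 0))
      \<longrightarrow> (\<forall>x. u\<^sub>1 x = 0))"
proof -
  interpret polar_setting AM g G AG act AN \<iota> by fact
  note unique = radial_solutions_unique[OF assms(4)]
  have u: "interior_solution f u\<^sub>1" "interior_solution f u\<^sub>2"
    using assms(5-10) interior_solutionI by blast+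
  show ?thesis
  proof (intro conjI impI allI; elim conjE bexE)
    fix x p
    assume "p \<in> \<Sigma>" "u\<^sub>1 p = u\<^sub>2 p" "\<forall>c\<in>AM. p \<in> fst c \<longrightarrow> grad g c u\<^sub>1 p = grad g c u\<^sub>2 p"
      and f: "radial_loc_lipschitz G act UNIV f \<or>
        (\<forall>x. 0 < u\<^sub>1 x \<and> 0 < u\<^sub>2 x) \<and> radial_loc_lipschitz G act {0<..} f"
    then have p: "p \<in> \<iota> ` regular_params AM G act \<iota>" "u\<^sub>1 p = u\<^sub>2 p"
      "\<And>c. c \<in> AM \<Longrightarrow> p \<in> fst c \<Longrightarrow> grad g c u\<^sub>1 p = grad g c u\<^sub>2 p"
      unfolding \<Sigma>_def by auto
    \<comment> \<open>The two alternatives for \<open>f\<close> differ only in the set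
      \<open>Y\<close> of admissible values.\<close>
    from f show "u\<^sub>1 x = u\<^sub>2 x"
    proof (elim disjE conjE)
      assume "radial_loc_lipschitz G act UNIV f"
      from unique[OF u UNIV_I UNIV_I this p] show ?thesis .
    next
      assume pos: "\<forall>x. 0 < u\<^sub>1 x \<and> 0 < u\<^sub>2 x" and f: "radial_loc_lipschitz G act {0<..} f"
      show ?thesis by (rule unique[OF u _ _ f p]) (use pos in auto)
    qed
  next
    fix x p
    assume f: "radial_loc_lipschitz G act UNIV f" "\<forall>x. f x 0 = 0"
      and p: "p \<in> \<Sigma>" "u\<^sub>1 p = 0" "\<forall>c\<in>AM. p \<in> fst c \<longrightarrow> grad g c u\<^sub>1 p = 0"
    \<comment> \<open>The second claim is uniqueness against the zero function, a solution because
      \<open>f x 0 = 0\<close>. Regularity of \<open>p\<close> makes the gradient of zero an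
      ordinary, two-sided one.\<close>
    have "p \<in> regular_points AM G act"
      using p(1) unfolding \<Sigma>_def regular_params_def by auto
    with p(3) have "grad g c u\<^sub>1 p = grad g c (\<lambda>x. 0) p" if "c \<in> AM" "p \<in> fst c" for c
      using grad_zero that by simp
    then show "u\<^sub>1 x = 0"
      using unique[OF u(1) zero_interior_solution[of f, OF spec[OF f(2)]] UNIV_I UNIV_I f(1)]
        p(1,2) unfolding \<Sigma>_def by blast
  qed
qed

end
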